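(* The category $\mathcal{CFE}$ of cographs and full embeddings is Noetherian over any Noetherian ring.
   Context: Rings are commutative with unit. For a ring $A$ and an essentially small category $\mathcal{C}$, a $\mathcal{C}$-module over $A$ is a (covariant) functor from $\mathcal{C}$ to $A$-modules; maps are natural transformations, and submodules, surjections, and direct sums are defined objectwise. The free module on an object $c_0$ sends $c$ to the free $A$-module on the set $\mathcal{C}(c_0,c)$. A $\mathcal{C}$-module is finitely generated if it admits a surjection from a finite direct sum of free modules. $\mathcal{C}$ is Noetherian over $A$ if submodules of finitely generated $\mathcal{C}$-modules over $A$ are again finitely generated. A simple graph is a finite simplicial complex of dimension at most $1$. An embedding of simple graphs is an injective simplicial map (equivalently, an injection on vertices preserving adjacency); it is full if it also reflects adjacency. The class of cographs is the smallest class of simple graphs such that: (1) the isolated vertex is a cograph; (2) a disjoint union of cographs is a cograph; (3) if $G$ is a cograph, then so is its complement, i.e. the graph with the same vertices as $G$ and with edges the non-edges of $G$. The category $\mathcal{CFE}$ has cographs as objects and full embeddings as morphisms. *)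

theory Defs
  imports "HOL-Algebra.Algebra"
begin

section \<open>Categories\<close>

text \<open>
  \<open>Comp C c d e g f\<close> is the composite of \<open>f : c \<rightarrow> d\<close> and \<open>g : d \<rightarrow> e\<close>. Hom-sets of different
  objects need not be disjoint, so source and target are passed along explicitly. The objects
  form a set of some HOL type, so every such category is small.
\<close>

record ('o, 'm) cat =
  Obj :: "'o set"
  Hom :: "'o \<Rightarrow> 'o \<Rightarrow> 'm set"
  Id :: "'o \<Rightarrow> 'm"
  Comp :: "'o \<Rightarrow> 'o \<Rightarrow> 'o \<Rightarrow> 'm \<Rightarrow> 'm \<Rightarrow> 'm"

locale category =
  fixes C :: "('o, 'm) cat"
  assumes Id_in_Hom: "c \<in> Obj C \<Longrightarrow> Id C c \<in> Hom C c c"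
    and Comp_in_Hom:
      "\<lbrakk>c \<in> Obj C; d \<in> Obj C; e \<in> Obj C; f \<in> Hom C c d; g \<in> Hom C d e\<rbrakk>
        \<Longrightarrow> Comp C c d e g f \<in> Hom C c e"
    and Comp_Id_right:
      "\<lbrakk>c \<in> Obj C; d \<in> Obj C; f \<in> Hom C c d\<rbrakk> \<Longrightarrow> Comp C c c d f (Id C c) = f"
    and Comp_Id_left:
      "\<lbrakk>c \<in> Obj C; d \<in> Obj C; f \<in> Hom C c d\<rbrakk> \<Longrightarrow> Comp C c d d (Id C d) f = f"
    and Comp_assoc:
      "\<lbrakk>b \<in> Obj C; c \<in> Obj C; d \<in> Obj C; e \<in> Obj C;
        f \<in> Hom C b c; g \<in> Hom C c d; h \<in> Hom C d e\<rbrakk>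
        \<Longrightarrow> Comp C b d e h (Comp C b c d g f) = Comp C b c e (Comp C c d e h g) f"


section \<open>Modules over a ring\<close>

definition module_hom ::
  "('a, 'r) ring_scheme \<Rightarrow> ('a, 'x) module \<Rightarrow> ('a, 'y) module \<Rightarrow> ('x \<Rightarrow> 'y) set" where
  "module_hom A M N =
    {h \<in> hom (add_monoid M) (add_monoid N).
      \<forall>a\<in>carrier A. \<forall>x\<in>carrier M. h (a \<odot>\<^bsub>M\<^esub> x) = a \<odot>\<^bsub>N\<^esub> h x}"

text \<open>
  The library's record of modules extends the record of rings; the fields \<open>mult\<close> and \<open>one\<close> play
  no role in the locale \<open>module\<close> and are left unspecified below.
\<close>

text \<open>Finitely supported functions \<open>S \<Rightarrow> A\<close>, extended by zero outside \<open>S\<close>.\<close>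

definition free_module :: "('a, 'r) ring_scheme \<Rightarrow> 's set \<Rightarrow> ('a, 's \<Rightarrow> 'a) module" where
  "free_module A S =
    \<lparr>carrier = {x. (\<forall>s\<in>S. x s \<in> carrier A) \<and> (\<forall>s. s \<notin> S \<longrightarrow> x s = \<zero>\<^bsub>A\<^esub>) \<and>
                   finite {s \<in> S. x s \<noteq> \<zero>\<^bsub>A\<^esub>}},
     monoid.mult = undefined, one = undefined,
     ring.zero = (\<lambda>s. \<zero>\<^bsub>A\<^esub>),
     ring.add = (\<lambda>x y s. x s \<oplus>\<^bsub>A\<^esub> y s),
     smult = (\<lambda>a x s. a \<otimes>\<^bsub>A\<^esub> x s)\<rparr>"

text \<open>The linear map between free modules induced by \<open>p : S \<rightarrow> T\<close> on bases.\<close>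

definition free_module_map ::
  "('a, 'r) ring_scheme \<Rightarrow> 's set \<Rightarrow> 't set \<Rightarrow> ('s \<Rightarrow> 't) \<Rightarrow> ('s \<Rightarrow> 'a) \<Rightarrow> ('t \<Rightarrow> 'a)" where
  "free_module_map A S T p x =
    (\<lambda>t. if t \<in> T then \<Oplus>\<^bsub>A\<^esub>s\<in>{s \<in> S. x s \<noteq> \<zero>\<^bsub>A\<^esub> \<and> p s = t}. x s else \<zero>\<^bsub>A\<^esub>)"

text \<open>This is the direct sum only for finite \<open>I\<close>.\<close>

definition direct_sum_module :: "'i set \<Rightarrow> ('i \<Rightarrow> ('a, 'x) module) \<Rightarrow> ('a, 'i \<Rightarrow> 'x) module" where
  "direct_sum_module I M =
    \<lparr>carrier = (\<Pi>\<^sub>E i\<in>I. carrier (M i)),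
     monoid.mult = undefined, one = undefined,
     ring.zero = (\<lambda>i\<in>I. \<zero>\<^bsub>M i\<^esub>),
     ring.add = (\<lambda>x y. \<lambda>i\<in>I. x i \<oplus>\<^bsub>M i\<^esub> y i),
     smult = (\<lambda>a x. \<lambda>i\<in>I. a \<odot>\<^bsub>M i\<^esub> x i)\<rparr>"


section \<open>Modules over a category\<close>

record ('o, 'm, 'a, 'x) cmod =
  at_obj :: "'o \<Rightarrow> ('a, 'x) module"
  at_hom :: "'o \<Rightarrow> 'o \<Rightarrow> 'm \<Rightarrow> 'x \<Rightarrow> 'x"

locale cat_module = category C + cring A
  for C :: "('o, 'm) cat" and A :: "('a, 'r) ring_scheme" (structure)
    and M :: "('o, 'm, 'a, 'x) cmod" +
  assumes module_at_obj: "c \<in> Obj C \<Longrightarrow> module A (at_obj M c)"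
    and hom_at_hom:
      "\<lbrakk>c \<in> Obj C; d \<in> Obj C; f \<in> Hom C c d\<rbrakk>
        \<Longrightarrow> at_hom M c d f \<in> module_hom A (at_obj M c) (at_obj M d)"
    and at_hom_Id:
      "\<lbrakk>c \<in> Obj C; x \<in> carrier (at_obj M c)\<rbrakk> \<Longrightarrow> at_hom M c c (Id C c) x = x"
    and at_hom_Comp:
      "\<lbrakk>c \<in> Obj C; d \<in> Obj C; e \<in> Obj C; f \<in> Hom C c d; g \<in> Hom C d e;
        x \<in> carrier (at_obj M c)\<rbrakk>
        \<Longrightarrow> at_hom M c e (Comp C c d e g f) x = at_hom M d e g (at_hom M c d f x)"

definition nat_trans ::
  "('o, 'm) cat \<Rightarrow> ('a, 'r) ring_scheme \<Rightarrow> ('o, 'm, 'a, 'x) cmod \<Rightarrow> ('o, 'm, 'a, 'y) cmod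
    \<Rightarrow> ('o \<Rightarrow> 'x \<Rightarrow> 'y) \<Rightarrow> bool" where
  "nat_trans C A M N \<phi> \<longleftrightarrow>
    (\<forall>c\<in>Obj C. \<phi> c \<in> module_hom A (at_obj M c) (at_obj N c)) \<and>
    (\<forall>c\<in>Obj C. \<forall>d\<in>Obj C. \<forall>f\<in>Hom C c d. \<forall>x\<in>carrier (at_obj M c).
      \<phi> d (at_hom M c d f x) = at_hom N c d f (\<phi> c x))"

definition surjection ::
  "('o, 'm) cat \<Rightarrow> ('a, 'r) ring_scheme \<Rightarrow> ('o, 'm, 'a, 'x) cmod \<Rightarrow> ('o, 'm, 'a, 'y) cmod
    \<Rightarrow> ('o \<Rightarrow> 'x \<Rightarrow> 'y) \<Rightarrow> bool" where
  "surjection C A M N \<phi> \<longleftrightarrow>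
    nat_trans C A M N \<phi> \<and>
    (\<forall>c\<in>Obj C. \<phi> c ` carrier (at_obj M c) = carrier (at_obj N c))"

definition sub_cmod ::
  "('o, 'm) cat \<Rightarrow> ('a, 'r) ring_scheme \<Rightarrow> ('o, 'm, 'a, 'x) cmod \<Rightarrow> ('o \<Rightarrow> 'x set) \<Rightarrow> bool" where
  "sub_cmod C A M N \<longleftrightarrow>
    (\<forall>c\<in>Obj C. submodule (N c) A (at_obj M c)) \<and>
    (\<forall>c\<in>Obj C. \<forall>d\<in>Obj C. \<forall>f\<in>Hom C c d. at_hom M c d f ` N c \<subseteq> N d)"

definition restrict_cmod ::
  "('o, 'm, 'a, 'x) cmod \<Rightarrow> ('o \<Rightarrow> 'x set) \<Rightarrow> ('o, 'm, 'a, 'x) cmod" where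
  "restrict_cmod M N =
    \<lparr>at_obj = (\<lambda>c. (at_obj M c)\<lparr>carrier := N c\<rparr>), at_hom = at_hom M\<rparr>"

definition direct_sum_cmod ::
  "'i set \<Rightarrow> ('i \<Rightarrow> ('o, 'm, 'a, 'x) cmod) \<Rightarrow> ('o, 'm, 'a, 'i \<Rightarrow> 'x) cmod" where
  "direct_sum_cmod I M =
    \<lparr>at_obj = (\<lambda>c. direct_sum_module I (\<lambda>i. at_obj (M i) c)),
     at_hom = (\<lambda>c d f x. \<lambda>i\<in>I. at_hom (M i) c d f (x i))\<rparr>"

definition free_cmod ::
  "('o, 'm) cat \<Rightarrow> ('a, 'r) ring_scheme \<Rightarrow> 'o \<Rightarrow> ('o, 'm, 'a, 'm \<Rightarrow> 'a) cmod" where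
  "free_cmod C A c\<^sub>0 =
    \<lparr>at_obj = (\<lambda>c. free_module A (Hom C c\<^sub>0 c)),
     at_hom = (\<lambda>c d f. free_module_map A (Hom C c\<^sub>0 c) (Hom C c\<^sub>0 d) (Comp C c\<^sub>0 c d f))\<rparr>"

definition finitely_generated ::
  "('o, 'm) cat \<Rightarrow> ('a, 'r) ring_scheme \<Rightarrow> ('o, 'm, 'a, 'x) cmod \<Rightarrow> bool" where
  "finitely_generated C A M \<longleftrightarrow>
    (\<exists>(n::nat) b \<phi>. (\<forall>i<n. b i \<in> Obj C) \<and>
      surjection C A (direct_sum_cmod {..<n} (\<lambda>i. free_cmod C A (b i))) M \<phi>)"

text \<open>
  HOL cannot quantify over types inside a formula, so the type \<open>'x\<close> in which the elements of the
  modules live is a parameter; a theorem about \<open>noetherian_over TYPE('x) C A\<close> with \<open>'x\<close> a type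
  variable is a statement about modules in every type.
\<close>

definition noetherian_over ::
  "'x itself \<Rightarrow> ('o, 'm) cat \<Rightarrow> ('a, 'r) ring_scheme \<Rightarrow> bool" where
  "noetherian_over _ C A \<longleftrightarrow>
    (\<forall>(M :: ('o, 'm, 'a, 'x) cmod) N.
      cat_module C A M \<and> finitely_generated C A M \<and> sub_cmod C A M N
        \<longrightarrow> finitely_generated C A (restrict_cmod M N))"


section \<open>Cographs and full embeddings\<close>

text \<open>A finite simplicial complex of dimension at most one, given by its vertices and its 1-simplices.\<close>

record 'v sgraph =
  verts :: "'v set"
  edges :: "'v set set"

definition simple_graph :: "'v sgraph \<Rightarrow> bool" where
  "simple_graph G \<longleftrightarrow> finite (verts G) \<and> edges G \<subseteq> {e. e \<subseteq> verts G \<and> card e = 2}"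

definition complement :: "'v sgraph \<Rightarrow> 'v sgraph" where
  "complement G = \<lparr>verts = verts G, edges = {e. e \<subseteq> verts G \<and> card e = 2} - edges G\<rparr>"

inductive cograph :: "'v sgraph \<Rightarrow> bool" where
  isolated_vertex: "cograph \<lparr>verts = {v}, edges = {}\<rparr>"
| disjoint_union: "\<lbrakk>cograph G; cograph H; verts G \<inter> verts H = {}\<rbrakk>
    \<Longrightarrow> cograph \<lparr>verts = verts G \<union> verts H, edges = edges G \<union> edges H\<rparr>"
| complement: "cograph G \<Longrightarrow> cograph (complement G)"

lemma cograph_simple_graph: "cograph G \<Longrightarrow> simple_graph G"
  by (induction rule: cograph.induct) (auto simp: simple_graph_def complement_def)

text \<open>
  Maps on vertices are taken to be \<open>undefined\<close> outside the source, so that equality of functions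
  is equality of maps.
\<close>

definition embeddings :: "'v sgraph \<Rightarrow> 'v sgraph \<Rightarrow> ('v \<Rightarrow> 'v) set" where
  "embeddings G H =
    {f \<in> verts G \<rightarrow>\<^sub>E verts H. inj_on f (verts G) \<and>
      (\<forall>u\<in>verts G. \<forall>v\<in>verts G. {u, v} \<in> edges G \<longrightarrow> {f u, f v} \<in> edges H)}"

definition full_embeddings :: "'v sgraph \<Rightarrow> 'v sgraph \<Rightarrow> ('v \<Rightarrow> 'v) set" where
  "full_embeddings G H =
    {f \<in> embeddings G H.
      \<forall>u\<in>verts G. \<forall>v\<in>verts G. {f u, f v} \<in> edges H \<longrightarrow> {u, v} \<in> edges G}"

text \<open>
  The vertices are drawn from the type \<open>'v\<close>. If \<open>'v\<close> is infinite, every cograph is isomorphic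
  to one of these.
\<close>

definition CFE :: "('v sgraph, 'v \<Rightarrow> 'v) cat" where
  "CFE =
    \<lparr>Obj = {G. cograph G},
     Hom = full_embeddings,
     Id = (\<lambda>G. \<lambda>v\<in>verts G. v),
     Comp = (\<lambda>G H K g f. compose (verts G) g f)\<rparr>"

lemma full_embeddings_compose:
  assumes f: "f \<in> full_embeddings G H" and g: "g \<in> full_embeddings H K"
  shows "compose (verts G) g f \<in> full_embeddings G K"
proof -
  have f': "f ` verts G \<subseteq> verts H" "inj_on f (verts G)"
    and g': "g ` verts H \<subseteq> verts K" "inj_on g (verts H)"
    using f g by (auto simp: full_embeddings_def embeddings_def)
  have "compose (verts G) g f \<in> verts G \<rightarrow>\<^sub>E verts K"
    using f'(1) g'(1) by (auto simp: compose_def)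
  moreover have "inj_on (compose (verts G) g f) (verts G)"
    using comp_inj_on[OF f'(2) inj_on_subset[OF g'(2) f'(1)]]
    by (simp add: compose_def inj_on_def)
  moreover have "{compose (verts G) g f u, compose (verts G) g f v} \<in> edges K
      \<longleftrightarrow> {u, v} \<in> edges G" if "u \<in> verts G" "v \<in> verts G" for u v
  proof -
    have "f u \<in> verts H" "f v \<in> verts H"
      using that f'(1) by blast+
    then have "{g (f u), g (f v)} \<in> edges K \<longleftrightarrow> {f u, f v} \<in> edges H"
      using g unfolding full_embeddings_def embeddings_def by blast
    also have "\<dots> \<longleftrightarrow> {u, v} \<in> edges G"
      using f that unfolding full_embeddings_def embeddings_def by blast
    finally show ?thesis
      using that by (simp add: compose_def)
  qed
  ultimately show ?thesis
    unfolding full_embeddings_def embeddings_def by blast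
qed

lemma full_embeddings_PiE: "f \<in> full_embeddings G H \<Longrightarrow> f \<in> verts G \<rightarrow>\<^sub>E verts H"
  by (simp add: full_embeddings_def embeddings_def)

lemma category_CFE: "category CFE"
proof
  fix b c d e :: "'v sgraph" and f g h :: "'v \<Rightarrow> 'v"
  show "Id CFE c \<in> Hom CFE c c"
    by (simp add: CFE_def full_embeddings_def embeddings_def inj_on_def)
  show "Comp CFE c d e g f \<in> Hom CFE c e" if "f \<in> Hom CFE c d" "g \<in> Hom CFE d e"
    using that full_embeddings_compose by (simp add: CFE_def)
  show "Comp CFE c c d f (Id CFE c) = f" if "f \<in> Hom CFE c d"
    using full_embeddings_PiE[of f c d] that
    by (intro ext) (auto simp: CFE_def compose_def PiE_def extensional_def)
  show "Comp CFE c d d (Id CFE d) f = f" if "f \<in> Hom CFE c d"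
    using full_embeddings_PiE[of f c d] that
    by (intro ext) (auto simp: CFE_def compose_def PiE_def extensional_def)
  show "Comp CFE b d e h (Comp CFE b c d g f) = Comp CFE b c e (Comp CFE c d e h g) f"
    if "f \<in> Hom CFE b c"
    using full_embeddings_PiE[of f b c] that
    by (intro ext) (auto simp: CFE_def compose_def PiE_def)
qed

end

theory Submission
  imports Defs "HOL-Library.Ramsey" "HOL-Library.List_Lenlexorder"
begin

text \<open>
  A cograph is the graph of a binary cotree, whose planar structure orders the vertices from left to
  right. Write a finitely generated module \<open>M\<close> as a quotient of \<open>P = \<Oplus>\<^sub>i \<langle>b\<^sub>i\<rangle>\<close>, with \<open>\<langle>b\<^sub>i\<rangle>\<close> free on \<open>b\<^sub>i\<close>. On the
  basis elements \<open>(i, g : b\<^sub>i \<rightarrow> G)\<close> of \<open>P(G)\<close> the vertex order induces a lexicographic order that is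
  preserved by postcomposition with order-preserving embeddings. Divisibility of basis elements under
  these embeddings is a well-quasi-order by Kruskal's theorem, applied to cotrees in which the leaf \<open>v\<close>
  is labelled by \<open>(i, g\<^sup>-\<^sup>1(v))\<close>.

  If a submodule \<open>N\<close> of \<open>M\<close> were not finitely generated, one could choose successively elements of \<open>P\<close>
  whose images lie in \<open>N\<close> but not in the submodule generated by the previous images, each with the
  smallest possible leading basis element. Along a subsequence of successively dividing leading basis
  elements, the ideals of leading coefficients attainable by the previous generators would increase
  strictly, which is impossible over a Noetherian ring.
\<close>

section \<open>Well-quasi-orders and Kruskal's theorem for cotrees\<close>

text \<open>A cograph may have nontrivial automorphisms, so no linear order on the basis elements
  \<open>(i, g)\<close> survives all full embeddings, and leading terms make sense only over a graph
  with a chosen cotree. No subcategory has to be built from these: submodules are closed under all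
  morphisms, so it suffices to have, between cotrees, some set of embeddings that is strictly
  monotone on basis elements and rich enough to make divisibility a well-quasi-order. The locale
  \<open>groebner_cover\<close> isolates this; several cotrees may lie over one graph.

  Two choices make the parts fit. The relation on cotrees keeps left and right apart and matches the
  Booleans of nodes, since the lowest common ancestor of two leaves decides both their order and
  their adjacency. The lists that rank basis elements are compared by length first and then
  lexicographically; this is a well-order on lists of naturals, so leading elements over different
  graphs can be compared and a smallest one exists.\<close>

definition wqo_on :: "('a \<Rightarrow> 'a \<Rightarrow> bool) \<Rightarrow> 'a set \<Rightarrow> bool" where
  "wqo_on P A \<longleftrightarrow> (\<forall>f::nat \<Rightarrow> 'a. range f \<subseteq> A \<longrightarrow> (\<exists>i j. i < j \<and> P (f i) (f j)))"

lemma wqo_on_good: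
  assumes "wqo_on P A" "\<And>k::nat. f k \<in> A"
  obtains i j where "i < j" "P (f i) (f j)"
  using assms unfolding wqo_on_def by (metis image_subsetI)

text \<open>\<open>P\<close> is an arbitrary relation, so good pairs cannot be chained by
  transitivity. Ramsey's theorem for pairs, coloured by whether \<open>P\<close> holds from the
  smaller to the larger index, gives a homogeneous infinite set; a good pair along it excludes the
  colour of failure.\<close>

lemma wqo_on_homogeneous_subseq:
  assumes "wqo_on P A" "\<And>k::nat. f k \<in> A"
  shows "\<exists>r::nat \<Rightarrow> nat. strict_mono r \<and> (\<forall>i j. i < j \<longrightarrow> P (f (r i)) (f (r j)))"
proof -
  define c :: "nat set \<Rightarrow> nat" where "c S = (if P (f (Min S)) (f (Max S)) then 0 else 1)" for S
  have "\<exists>Y t. Y \<subseteq> UNIV \<and> infinite Y \<and> t < 2 \<and> (\<forall>x\<in>Y. \<forall>y\<in>Y. x \<noteq> y \<longrightarrow> c {x, y} = t)"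
    by (rule Ramsey2) (auto simp: c_def)
  then obtain Y t where Y: "infinite Y" and t: "\<And>x y. x \<in> Y \<Longrightarrow> y \<in> Y \<Longrightarrow> x \<noteq> y \<Longrightarrow> c {x, y} = t"
    by auto
  define r where "r = enumerate Y"
  have r: "strict_mono r" "\<And>i. r i \<in> Y"
    using Y by (auto simp: r_def strict_mono_enumerate enumerate_in_set)
  have c: "c {r i, r j} = (if P (f (r i)) (f (r j)) then 0 else 1)" if "i < j" for i j
    using strict_monoD[OF r(1) that] by (simp add: c_def)
  have ct: "c {r i, r j} = t" if "i < j" for i j
    using t[OF r(2) r(2)] strict_monoD[OF r(1) that] by simp
  obtain i j where "i < j" "P (f (r i)) (f (r j))"
    using wqo_on_good[of P A "\<lambda>k. f (r k)"] assms by blast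
  then have "t = 0"
    using c ct by fastforce
  then have "P (f (r i)) (f (r j))" if "i < j" for i j
    using c[OF that] ct[OF that] by (simp split: if_splits)
  with r(1) show ?thesis by blast
qed

lemma wqo_on_eq_finite: "finite A \<Longrightarrow> wqo_on (=) A"
  unfolding wqo_on_def
proof (intro allI impI)
  fix f :: "nat \<Rightarrow> 'a"
  assume "finite A" "range f \<subseteq> A"
  then have "\<not> inj f"
    using finite_subset range_inj_infinite by blast
  then show "\<exists>i j. i < j \<and> f i = f j"
    by (metis injI linorder_neqE_nat)
qed

definition bad_sequence :: "('a \<Rightarrow> 'a \<Rightarrow> bool) \<Rightarrow> 'a set \<Rightarrow> (nat \<Rightarrow> 'a) \<Rightarrow> bool" where
  "bad_sequence P A f \<longleftrightarrow> (\<forall>k. f k \<in> A) \<and> (\<forall>i j. i < j \<longrightarrow> \<not> P (f i) (f j))"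

text \<open>Nash-Williams' construction. Stage \<open>n\<close> chooses a bad sequence whose entry
  \<open>n\<close> has least \<open>\<mu>\<close> among those with the same first \<open>n\<close>
  entries; later stages leave the entries up to \<open>n\<close> alone. The diagonal stays bad
  because any pair \<open>i < j\<close> already occurs in stage \<open>j\<close>.\<close>

lemma minimal_bad_sequence:
  fixes \<mu> :: "'a \<Rightarrow> nat"
  assumes "\<not> wqo_on P A"
  shows "\<exists>f. bad_sequence P A f \<and>
    (\<forall>g k. bad_sequence P A g \<longrightarrow> (\<forall>i<k. g i = f i) \<longrightarrow> \<mu> (f k) \<le> \<mu> (g k))"
proof -
  let ?bad = "bad_sequence P A"
  define least where
    "least k h \<longleftrightarrow> ?bad h \<and> (\<forall>g. ?bad g \<and> (\<forall>i<k. g i = h i) \<longrightarrow> \<mu> (h k) \<le> \<mu> (g k))" for k h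
  have step: "\<exists>h'. least k h' \<and> (\<forall>i<k. h' i = h i)" if "?bad h" for h k
  proof -
    have "\<exists>h'. (?bad h' \<and> (\<forall>i<k. h' i = h i)) \<and>
        (\<forall>g. ?bad g \<and> (\<forall>i<k. g i = h i) \<longrightarrow> \<mu> (h' k) \<le> \<mu> (g k))"
      using that by (intro ex_has_least_nat[of _ h]) simp
    then obtain h' where "?bad h' \<and> (\<forall>i<k. h' i = h i)"
      and "\<forall>g. ?bad g \<and> (\<forall>i<k. g i = h i) \<longrightarrow> \<mu> (h' k) \<le> \<mu> (g k)"
      by (elim exE conjE) simp
    then show ?thesis
      unfolding least_def by (intro exI[of _ h']) auto
  qed
  obtain h where "?bad h"
    using assms unfolding wqo_on_def bad_sequence_def by blast
  have "\<exists>F. \<forall>n. least n (F n) \<and> (\<forall>i\<le>n. F (Suc n) i = F n i)"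
  proof (rule dependent_nat_choice)
    show "\<exists>x. least 0 x" using step[OF \<open>?bad h\<close>, of 0] by blast
    show "\<exists>y. least (Suc n) y \<and> (\<forall>i\<le>n. y i = x i)" if "least n x" for x n
      using step[of x "Suc n"] that unfolding least_def by (metis less_Suc_eq_le)
  qed
  then obtain F where F: "\<And>n. least n (F n)" and FS: "\<And>n i. i \<le> n \<Longrightarrow> F (Suc n) i = F n i"
    by blast
  have Fle: "F m i = F i i" if "i \<le> m" for i m
    using that by (induction m rule: dec_induct) (auto simp: FS)
  have bad: "?bad (F n)" for n
    using F unfolding least_def by blast
  show ?thesis
  proof (intro exI[of _ "\<lambda>k. F k k"] conjI allI impI)
    show "?bad (\<lambda>k. F k k)"
      unfolding bad_sequence_def
    proof (intro conjI allI impI)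
      show "F k k \<in> A" for k
        using bad[of k] by (simp add: bad_sequence_def)
      show "\<not> P (F i i) (F j j)" if "i < j" for i j
      proof -
        have "F j i = F i i" using Fle[of i j] that by simp
        then show ?thesis using bad[of j] that unfolding bad_sequence_def by metis
      qed
    qed
    show "\<mu> (F k k) \<le> \<mu> (g k)" if "?bad g" "\<forall>i<k. g i = F i i" for g k
    proof -
      have "\<forall>i<k. g i = F k i" using that(2) Fle[of _ k] by simp
      then show ?thesis using F[of k] that(1) unfolding least_def by blast
    qed
  qed
qed

text \<open>The Boolean of a node tells whether the two sides are completely joined or disjoint.\<close>

datatype 'a cotree = Leaf 'a | Node bool "'a cotree" "'a cotree"

text \<open>Homeomorphic embedding of planar trees. Every node of the smaller tree is matched with a
  node of the same Boolean, left side to left side and right side to right side, so the order and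
  the adjacency of two leaves, both decided at their lowest common ancestor, are kept.\<close>

inductive emb :: "('a \<Rightarrow> 'b \<Rightarrow> bool) \<Rightarrow> 'a cotree \<Rightarrow> 'b cotree \<Rightarrow> bool" for R where
  emb_Leaf: "R a b \<Longrightarrow> emb R (Leaf a) (Leaf b)"
| emb_left: "emb R s l \<Longrightarrow> emb R s (Node b l r)"
| emb_right: "emb R s r \<Longrightarrow> emb R s (Node b l r)"
| emb_Node: "emb R l l' \<Longrightarrow> emb R r r' \<Longrightarrow> emb R (Node b l r) (Node b l' r')"

text \<open>\<open>map_cotree\<close> changes only the leaves, so an embedding between relabelled
  trees is one between the trees themselves. Kruskal's theorem, applied to trees with finitely many
  labels, is carried back in this way to cotrees with vertices as leaves.\<close>

lemma emb_map: "emb R (map_cotree f s) (map_cotree g t) \<Longrightarrow> emb (\<lambda>x y. R (f x) (g y)) s t"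
proof -
  have "emb (\<lambda>x y. R (f x) (g y)) s t"
    if "emb R s' t'" "s' = map_cotree f s" "t' = map_cotree g t" for s' t' s t
    using that
  proof (induction arbitrary: s t rule: emb.induct)
    case (emb_Leaf a b)
    obtain x where x: "s = Leaf x" "a = f x"
      using emb_Leaf.prems(1) by (cases s) simp_all
    obtain y where y: "t = Leaf y" "b = g y"
      using emb_Leaf.prems(2) by (cases t) simp_all
    show ?case
      using emb_Leaf.hyps x y by (simp add: emb.emb_Leaf)
  next
    case (emb_left s' l b r)
    obtain l0 r0 where t: "t = Node b l0 r0" "l = map_cotree g l0"
      using emb_left.prems(2) by (cases t) simp_all
    show ?case
      unfolding t by (rule emb.emb_left, rule emb_left.IH[OF emb_left.prems(1) t(2)])
  next
    case (emb_right s' r b l)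
    obtain l0 r0 where t: "t = Node b l0 r0" "r = map_cotree g r0"
      using emb_right.prems(2) by (cases t) simp_all
    show ?case
      unfolding t by (rule emb.emb_right, rule emb_right.IH[OF emb_right.prems(1) t(2)])
  next
    case (emb_Node l l' r r' b)
    obtain l0 r0 where s: "s = Node b l0 r0" "l = map_cotree f l0" "r = map_cotree f r0"
      using emb_Node.prems(1) by (cases s) simp_all
    obtain l1 r1 where t: "t = Node b l1 r1" "l' = map_cotree g l1" "r' = map_cotree g r1"
      using emb_Node.prems(2) by (cases t) simp_all
    show ?case
      unfolding s(1) t(1)
      by (rule emb.emb_Node, rule emb_Node.IH(1)[OF s(2) t(2)], rule emb_Node.IH(2)[OF s(3) t(3)])
  qed
  then show "emb R (map_cotree f s) (map_cotree g t) \<Longrightarrow> emb (\<lambda>x y. R (f x) (g y)) s t"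
    by blast
qed

text \<open>In a bad sequence of minimal sizes the immediate subtrees are well-quasi-ordered.
  Thinning the sequence to one kind of root gives either leaves, compared by \<open>R\<close>, or
  nodes with one Boolean, where a subsequence ascending in the left subtrees contains a good pair of
  right subtrees.\<close>

theorem wqo_on_emb:
  assumes R: "wqo_on R A"
  shows "wqo_on (emb R) {t. set_cotree t \<subseteq> A}"
proof (rule ccontr)
  assume "\<not> ?thesis"
  then obtain f where f: "bad_sequence (emb R) {t. set_cotree t \<subseteq> A} f"
    and least: "\<And>g k. \<lbrakk>bad_sequence (emb R) {t. set_cotree t \<subseteq> A} g; \<forall>i<k. g i = f i\<rbrakk>
      \<Longrightarrow> size (f k) \<le> size (g k)"
    using minimal_bad_sequence[of "emb R" _ size] by metis
  have fA: "set_cotree (f k) \<subseteq> A" and bad: "i < j \<Longrightarrow> \<not> emb R (f i) (f j)" for i j k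
    using f by (simp_all add: bad_sequence_def)
  \<comment> \<open>Each subtree is stored with the index of the tree it comes from, because the
    splicing below needs that index.\<close>
  define sub where "sub = {(k, s) | k s. \<exists>b l r. f k = Node b l r \<and> (s = l \<or> s = r)}"
  have sub: "set_cotree s \<subseteq> A" "size s < size (f k)" "emb R t s \<Longrightarrow> emb R t (f k)"
    if ks: "(k, s) \<in> sub" for k s t
  proof -
    obtain b l r where k: "f k = Node b l r" and s: "s = l \<or> s = r"
      using ks unfolding sub_def by blast
    show "set_cotree s \<subseteq> A" "size s < size (f k)"
      using fA[of k] k s by auto
    show "emb R t (f k)" if "emb R t s"
      unfolding k using s
    proof
      show "emb R t (Node b l r)" if "s = l"
        using \<open>emb R t s\<close> unfolding that by (rule emb_left)
      show "emb R t (Node b l r)" if "s = r"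
        using \<open>emb R t s\<close> unfolding that by (rule emb_right)
    qed
  qed
  have wqo_sub: "wqo_on (emb R) (snd ` sub)"
    unfolding wqo_on_def
  proof (intro allI impI, rule ccontr)
    fix g :: "nat \<Rightarrow> _"
    assume g: "range g \<subseteq> snd ` sub" and gbad: "\<not> (\<exists>i j. i < j \<and> emb R (g i) (g j))"
    have "\<forall>i. \<exists>k. (k, g i) \<in> sub"
    proof
      fix i
      have "g i \<in> snd ` sub" using g by blast
      then show "\<exists>k. (k, g i) \<in> sub" by auto
    qed
    then obtain n where n: "\<And>i. (n i, g i) \<in> sub" by metis
    \<comment> \<open>The splice has to start at the earliest tree that contributes to
      \<open>g\<close>, so that every other \<open>g i\<close> comes from an index that is no
      smaller.\<close>
    define p where "p = (ARG_MIN n i. True)"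
    have p: "n p \<le> n i" for i
      unfolding p_def by (rule arg_min_nat_le) simp
    define h where "h i = (if i < n p then f i else g (i - n p + p))" for i
    have "size (f (n p)) \<le> size (h (n p))"
    proof (rule least)
      show "\<forall>i<n p. h i = f i" by (simp add: h_def)
      have "h i \<in> {t. set_cotree t \<subseteq> A}" for i
        using fA[of i] sub(1)[OF n] by (simp add: h_def)
      moreover have "\<not> emb R (h i) (h j)" if "i < j" for i j
      proof (cases "i < n p \<and> \<not> j < n p")
        case True
        \<comment> \<open>An embedding of \<open>f i\<close> into a subtree taken from
          \<open>g\<close> would extend to the tree containing that subtree, whose index exceeds
          \<open>i\<close>.\<close>
        then have "i < n (j - n p + p)" using p[of "j - n p + p"] by linarith
        then show ?thesis using True bad sub(3)[OF n] by (simp add: h_def) blast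
      next
        case False
        with that consider "i < n p" "j < n p" | "\<not> i < n p" "\<not> j < n p" by linarith
        then show ?thesis
        proof cases
          case 1
          then show ?thesis using bad that by (simp add: h_def)
        next
          case 2
          then have "i - n p + p < j - n p + p" using that by linarith
          then show ?thesis using 2 gbad by (auto simp: h_def)
        qed
      qed
      ultimately show "bad_sequence (emb R) {t. set_cotree t \<subseteq> A} h"
        by (simp add: bad_sequence_def)
    qed
    moreover have "h (n p) = g p" by (simp add: h_def)
    ultimately show False using sub(2)[OF n[of p]] by simp
  qed
  define shape where "shape t = (case t of Leaf _ \<Rightarrow> None | Node b _ _ \<Rightarrow> Some b)" for t :: "'a cotree"
  have "\<exists>r::nat \<Rightarrow> nat. strict_mono r \<and> (\<forall>i j. i < j \<longrightarrow> shape (f (r i)) = shape (f (r j)))"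
    by (rule wqo_on_homogeneous_subseq[OF wqo_on_eq_finite[of UNIV], where f = "\<lambda>k. shape (f k)"])
      simp_all
  then obtain r :: "nat \<Rightarrow> nat" where r: "strict_mono r" "\<And>i j. i < j \<Longrightarrow> shape (f (r i)) = shape (f (r j))"
    by (elim exE conjE) simp
  have rbad: "\<not> emb R (f (r i)) (f (r j))" if "i < j" for i j
    using bad strict_monoD[OF r(1) that] .
  have shape: "shape (f (r i)) = shape (f (r 0))" for i
    using r(2)[of 0 i] by (cases i) auto
  show False
  proof (cases "shape (f (r 0))")
    case None
    then have "\<exists>a. f (r i) = Leaf a" for i
      using shape[of i] by (auto simp: shape_def split: cotree.splits)
    then obtain a where a: "\<And>i. f (r i) = Leaf (a i)" by metis
    have "a i \<in> A" for i using fA[of "r i"] a[of i] by auto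
    then obtain i j where "i < j" "R (a i) (a j)" by (rule wqo_on_good[OF R])
    then show False using rbad[of i j] emb.emb_Leaf[of R "a i" "a j"] by (simp add: a)
  next
    case (Some b)
    then have "\<exists>s t. f (r i) = Node b s t" for i
      using shape[of i] by (auto simp: shape_def split: cotree.splits)
    then obtain s t where st: "\<And>i. f (r i) = Node b (s i) (t i)" by metis
    then have "(r i, s i) \<in> sub" "(r i, t i) \<in> sub" for i by (auto simp: sub_def)
    then have st_sub: "s i \<in> snd ` sub" "t i \<in> snd ` sub" for i
      by (metis imageI snd_conv, metis imageI snd_conv)
    obtain q :: "nat \<Rightarrow> nat" where q: "strict_mono q" "\<And>i j. i < j \<Longrightarrow> emb R (s (q i)) (s (q j))"
      using wqo_on_homogeneous_subseq[OF wqo_sub, of s, OF st_sub(1)] by (elim exE conjE) simp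
    obtain i j where "i < j" "emb R (t (q i)) (t (q j))"
      by (rule wqo_on_good[OF wqo_sub, of "\<lambda>i. t (q i)"]) (rule st_sub(2))
    moreover from this have "emb R (s (q i)) (s (q j))" "q i < q j"
      using q(2) strict_monoD[OF q(1)] by simp_all
    ultimately show False
      using rbad[of "q i" "q j"] by (simp add: st emb_Node)
  qed
qed

section \<open>Generators of modules over a category\<close>

lemma module_hom_closed: "h \<in> module_hom A M N \<Longrightarrow> x \<in> carrier M \<Longrightarrow> h x \<in> carrier N"
  and module_hom_add: "h \<in> module_hom A M N \<Longrightarrow> x \<in> carrier M \<Longrightarrow> y \<in> carrier M
    \<Longrightarrow> h (x \<oplus>\<^bsub>M\<^esub> y) = h x \<oplus>\<^bsub>N\<^esub> h y"
  and module_hom_smult: "h \<in> module_hom A M N \<Longrightarrow> a \<in> carrier A \<Longrightarrow> x \<in> carrier M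
    \<Longrightarrow> h (a \<odot>\<^bsub>M\<^esub> x) = a \<odot>\<^bsub>N\<^esub> h x"
  by (auto simp: module_hom_def hom_def)

lemma module_hom_zero:
  assumes "module A M" "module A N" "h \<in> module_hom A M N"
  shows "h \<zero>\<^bsub>M\<^esub> = \<zero>\<^bsub>N\<^esub>"
proof -
  interpret M: module A M by fact
  interpret N: module A N by fact
  have "h \<zero>\<^bsub>M\<^esub> = h (\<zero>\<^bsub>A\<^esub> \<odot>\<^bsub>M\<^esub> \<zero>\<^bsub>M\<^esub>)" by simp
  also have "\<dots> = \<zero>\<^bsub>N\<^esub>"
    using module_hom_smult[OF assms(3) M.R.zero_closed M.M.zero_closed]
      module_hom_closed[OF assms(3) M.M.zero_closed] by simp
  finally show ?thesis .
qed

lemma module_hom_finsum: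
  assumes M: "module A M" and N: "module A N" and h: "h \<in> module_hom A M N"
    and "finite S" "f \<in> S \<rightarrow> carrier M"
  shows "h (\<Oplus>\<^bsub>M\<^esub>s\<in>S. f s) = (\<Oplus>\<^bsub>N\<^esub>s\<in>S. h (f s))"
proof -
  interpret M: module A M by fact
  interpret N: module A N by fact
  show ?thesis
    using assms(4,5)
  proof (induction S rule: finite_induct)
    case empty
    then show ?case using module_hom_zero[OF M N h] by simp
  next
    case (insert s S)
    then have "h (f s \<oplus>\<^bsub>M\<^esub> (\<Oplus>\<^bsub>M\<^esub>s\<in>S. f s)) = h (f s) \<oplus>\<^bsub>N\<^esub> (\<Oplus>\<^bsub>N\<^esub>s\<in>S. h (f s))"
      using module_hom_add[OF h, of "f s" "\<Oplus>\<^bsub>M\<^esub>s\<in>S. f s"] by auto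
    with insert show ?case
      by (simp add: module_hom_closed[OF h] Pi_def)
  qed
qed

lemma (in module) finsum_smult_rdistr:
  assumes "finite S" "f \<in> S \<rightarrow> carrier R" "x \<in> carrier M"
  shows "(\<Oplus>i\<in>S. f i) \<odot>\<^bsub>M\<^esub> x = (\<Oplus>\<^bsub>M\<^esub>i\<in>S. f i \<odot>\<^bsub>M\<^esub> x)"
  using assms
proof (induction S rule: finite_induct)
  case (insert s S)
  then have "f s \<in> carrier R" "f \<in> S \<rightarrow> carrier R" "(\<lambda>i. f i \<odot>\<^bsub>M\<^esub> x) \<in> S \<rightarrow> carrier M"
    by auto
  with insert show ?case
    by (simp add: smult_l_distr)
qed simp

lemma (in abelian_monoid) finsum_fibers:
  assumes "finite S" "finite T" "p \<in> S \<rightarrow> T" "f \<in> S \<rightarrow> carrier G"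
  shows "(\<Oplus>t\<in>T. \<Oplus>s\<in>{s \<in> S. p s = t}. f s) = (\<Oplus>s\<in>S. f s)"
proof -
  have "finsum G f (\<Union>t\<in>T. {s \<in> S. p s = t}) = (\<Oplus>t\<in>T. \<Oplus>s\<in>{s \<in> S. p s = t}. f s)"
    using assms by (intro add.finprod_UN_disjoint) (auto simp: pairwise_def disjnt_def)
  moreover have "(\<Union>t\<in>T. {s \<in> S. p s = t}) = S"
    using assms(3) by auto
  ultimately show ?thesis by simp
qed

text \<open>The inner sum is the coefficient at \<open>t\<close> produced by
  \<open>free_module_map\<close>, so this identity is the core of naturality for maps out of a free
  module. Both sides add the same terms, on the left grouped by the fibres of \<open>p\<close>;
  dropping zero coefficients changes no sum.\<close>

lemma (in module) finsum_pushforward: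
  assumes S: "finite S" and T: "finite T" and p: "p \<in> S \<rightarrow> T"
    and a: "a \<in> S \<rightarrow> carrier R" and e: "e \<in> T \<rightarrow> carrier M"
  shows "(\<Oplus>\<^bsub>M\<^esub>t\<in>T. (\<Oplus>s\<in>{s \<in> S. a s \<noteq> \<zero> \<and> p s = t}. a s) \<odot>\<^bsub>M\<^esub> e t) = (\<Oplus>\<^bsub>M\<^esub>s\<in>S. a s \<odot>\<^bsub>M\<^esub> e (p s))"
proof -
  have "(\<Oplus>s\<in>{s \<in> S. a s \<noteq> \<zero> \<and> p s = t}. a s) \<odot>\<^bsub>M\<^esub> e t
      = (\<Oplus>\<^bsub>M\<^esub>s\<in>{s \<in> S. p s = t}. a s \<odot>\<^bsub>M\<^esub> e (p s))" if t: "t \<in> T" for t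
  proof -
    have "(\<Oplus>s\<in>{s \<in> S. a s \<noteq> \<zero> \<and> p s = t}. a s) = (\<Oplus>s\<in>{s \<in> S. p s = t}. a s)"
      using S a by (intro R.add.finprod_mono_neutral_cong_left) auto
    also have "\<dots> \<odot>\<^bsub>M\<^esub> e t = (\<Oplus>\<^bsub>M\<^esub>s\<in>{s \<in> S. p s = t}. a s \<odot>\<^bsub>M\<^esub> e t)"
      using S a e t by (intro finsum_smult_rdistr) auto
    also have "\<dots> = (\<Oplus>\<^bsub>M\<^esub>s\<in>{s \<in> S. p s = t}. a s \<odot>\<^bsub>M\<^esub> e (p s))"
      using a e t by (intro M.finsum_cong') auto
    finally show ?thesis .
  qed
  then have "(\<Oplus>\<^bsub>M\<^esub>t\<in>T. (\<Oplus>s\<in>{s \<in> S. a s \<noteq> \<zero> \<and> p s = t}. a s) \<odot>\<^bsub>M\<^esub> e t)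
      = (\<Oplus>\<^bsub>M\<^esub>t\<in>T. \<Oplus>\<^bsub>M\<^esub>s\<in>{s \<in> S. p s = t}. a s \<odot>\<^bsub>M\<^esub> e (p s))"
    using a e p by (intro M.finsum_cong') (auto intro!: M.finsum_closed)
  also have "\<dots> = (\<Oplus>\<^bsub>M\<^esub>s\<in>S. a s \<odot>\<^bsub>M\<^esub> e (p s))"
    using a e p by (intro M.finsum_fibers[OF S T p]) auto
  finally show ?thesis .
qed

section \<open>Free modules and finite direct sums\<close>

lemma free_module_simps:
  "carrier (free_module A S) = {x. (\<forall>s\<in>S. x s \<in> carrier A) \<and> (\<forall>s. s \<notin> S \<longrightarrow> x s = \<zero>\<^bsub>A\<^esub>) \<and>
     finite {s \<in> S. x s \<noteq> \<zero>\<^bsub>A\<^esub>}}"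
  "\<zero>\<^bsub>free_module A S\<^esub> = (\<lambda>s. \<zero>\<^bsub>A\<^esub>)"
  "x \<oplus>\<^bsub>free_module A S\<^esub> y = (\<lambda>s. x s \<oplus>\<^bsub>A\<^esub> y s)"
  "a \<odot>\<^bsub>free_module A S\<^esub> x = (\<lambda>s. a \<otimes>\<^bsub>A\<^esub> x s)"
  by (simp_all add: free_module_def)

lemma direct_sum_module_simps:
  "carrier (direct_sum_module I M) = (\<Pi>\<^sub>E i\<in>I. carrier (M i))"
  "\<zero>\<^bsub>direct_sum_module I M\<^esub> = (\<lambda>i\<in>I. \<zero>\<^bsub>M i\<^esub>)"
  "x \<oplus>\<^bsub>direct_sum_module I M\<^esub> y = (\<lambda>i\<in>I. x i \<oplus>\<^bsub>M i\<^esub> y i)"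
  "a \<odot>\<^bsub>direct_sum_module I M\<^esub> x = (\<lambda>i\<in>I. a \<odot>\<^bsub>M i\<^esub> x i)"
  by (simp_all add: direct_sum_module_def)

lemma (in cring) free_module_in_carrier:
  "x \<in> carrier (free_module R S) \<Longrightarrow> x s \<in> carrier R"
  by (cases "s \<in> S") (auto simp: free_module_simps)

lemma (in cring) module_free_module: "module R (free_module R S)"
proof (rule moduleI)
  let ?F = "free_module R S"
  have add: "x \<oplus>\<^bsub>?F\<^esub> y \<in> carrier ?F" if "x \<in> carrier ?F" "y \<in> carrier ?F" for x y
  proof -
    have "{s \<in> S. x s \<oplus> y s \<noteq> \<zero>} \<subseteq> {s \<in> S. x s \<noteq> \<zero>} \<union> {s \<in> S. y s \<noteq> \<zero>}"
      by auto
    then have "finite {s \<in> S. x s \<oplus> y s \<noteq> \<zero>}"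
      using that by (auto simp: free_module_simps intro: finite_subset)
    then show ?thesis using that by (simp add: free_module_simps)
  qed
  show smult: "a \<odot>\<^bsub>?F\<^esub> x \<in> carrier ?F" if "a \<in> carrier R" "x \<in> carrier ?F" for a x
  proof -
    have "{s \<in> S. a \<otimes> x s \<noteq> \<zero>} \<subseteq> {s \<in> S. x s \<noteq> \<zero>}"
      using that by auto
    then have "finite {s \<in> S. a \<otimes> x s \<noteq> \<zero>}"
      using that by (auto simp: free_module_simps intro: finite_subset)
    then show ?thesis using that by (simp add: free_module_simps)
  qed
  show "abelian_group ?F"
  proof (rule abelian_groupI)
    show "\<zero>\<^bsub>?F\<^esub> \<in> carrier ?F" by (simp add: free_module_simps)
    show "\<exists>y\<in>carrier ?F. y \<oplus>\<^bsub>?F\<^esub> x = \<zero>\<^bsub>?F\<^esub>" if "x \<in> carrier ?F" for x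
    proof
      show "(\<ominus> \<one>) \<odot>\<^bsub>?F\<^esub> x \<in> carrier ?F" using that by (simp add: smult)
      show "(\<ominus> \<one>) \<odot>\<^bsub>?F\<^esub> x \<oplus>\<^bsub>?F\<^esub> x = \<zero>\<^bsub>?F\<^esub>"
        using free_module_in_carrier[OF that] by (simp add: free_module_simps l_minus l_neg)
    qed
  qed (use free_module_in_carrier[of _ S] in \<open>simp_all add: add\<close>,
      simp_all add: free_module_simps(2,3) a_ac)
  show "(a \<oplus> b) \<odot>\<^bsub>?F\<^esub> x = a \<odot>\<^bsub>?F\<^esub> x \<oplus>\<^bsub>?F\<^esub> b \<odot>\<^bsub>?F\<^esub> x"
    "(a \<otimes> b) \<odot>\<^bsub>?F\<^esub> x = a \<odot>\<^bsub>?F\<^esub> (b \<odot>\<^bsub>?F\<^esub> x)"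
    if "a \<in> carrier R" "b \<in> carrier R" "x \<in> carrier ?F" for a b x
    using free_module_in_carrier[OF that(3)] that
    by (simp_all add: free_module_simps(3,4) l_distr m_assoc)
  show "a \<odot>\<^bsub>?F\<^esub> (x \<oplus>\<^bsub>?F\<^esub> y) = a \<odot>\<^bsub>?F\<^esub> x \<oplus>\<^bsub>?F\<^esub> a \<odot>\<^bsub>?F\<^esub> y"
    if "a \<in> carrier R" "x \<in> carrier ?F" "y \<in> carrier ?F" for a x y
    using free_module_in_carrier[OF that(2)] free_module_in_carrier[OF that(3)] that
    by (simp add: free_module_simps(3,4) r_distr)
  show "\<one> \<odot>\<^bsub>?F\<^esub> x = x" if "x \<in> carrier ?F" for x
    using free_module_in_carrier[OF that] by (simp add: free_module_simps(4))
qed (rule cring_axioms)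

lemma (in cring) module_direct_sum_module:
  assumes M: "\<And>i. i \<in> I \<Longrightarrow> module R (M i)"
  shows "module R (direct_sum_module I M)"
proof (rule moduleI)
  let ?D = "direct_sum_module I M"
  note module.smult_closed[OF M, simp] module.smult_l_distr[OF M, simp]
    module.smult_r_distr[OF M, simp] module.smult_assoc1[OF M, simp] module.smult_one[OF M, simp]
  have ab: "abelian_group (M i)" if "i \<in> I" for i
    using module.axioms(2)[OF M[OF that]] .
  note mon = abelian_group.axioms(1)[OF ab]
  note [simp] = abelian_monoid.a_closed[OF mon] abelian_monoid.a_assoc[OF mon]
    abelian_monoid.zero_closed[OF mon] abelian_monoid.l_zero[OF mon]
  have mem: "x i \<in> carrier (M i)" if "x \<in> carrier ?D" "i \<in> I" for x i
    using that by (auto simp: direct_sum_module_simps)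
  have ext: "x = y" if "x \<in> carrier ?D" "y \<in> carrier ?D" "\<And>i. i \<in> I \<Longrightarrow> x i = y i" for x y
    using that unfolding direct_sum_module_simps by (rule PiE_ext)
  show smult: "a \<odot>\<^bsub>?D\<^esub> x \<in> carrier ?D" if "a \<in> carrier R" "x \<in> carrier ?D" for a x
    using that mem[of x] by (simp add: direct_sum_module_simps)
  have add: "x \<oplus>\<^bsub>?D\<^esub> y \<in> carrier ?D" if "x \<in> carrier ?D" "y \<in> carrier ?D" for x y
    using that mem[of x] mem[of y] by (simp add: direct_sum_module_simps)
  have zero: "\<zero>\<^bsub>?D\<^esub> \<in> carrier ?D"
    by (simp add: direct_sum_module_simps)
  note [simp] = direct_sum_module_simps(2,3,4)
  show "abelian_group ?D"
  proof (rule abelian_groupI)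
    show "\<exists>y\<in>carrier ?D. y \<oplus>\<^bsub>?D\<^esub> x = \<zero>\<^bsub>?D\<^esub>" if x: "x \<in> carrier ?D" for x
    proof
      show *: "(\<ominus> \<one>) \<odot>\<^bsub>?D\<^esub> x \<in> carrier ?D" using x smult by simp
      have "((\<ominus> \<one>) \<odot>\<^bsub>M i\<^esub> x i) \<oplus>\<^bsub>M i\<^esub> x i = \<zero>\<^bsub>M i\<^esub>" if "i \<in> I" for i
        using module.smult_l_minus[OF M one_closed mem, OF that x that] mem[OF x that]
          abelian_group.l_neg[OF ab[OF that]] that by simp
      then show "(\<ominus> \<one>) \<odot>\<^bsub>?D\<^esub> x \<oplus>\<^bsub>?D\<^esub> x = \<zero>\<^bsub>?D\<^esub>"
        by (intro ext add * x zero) simp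
    qed
    show "x \<oplus>\<^bsub>?D\<^esub> y = y \<oplus>\<^bsub>?D\<^esub> x" if "x \<in> carrier ?D" "y \<in> carrier ?D" for x y
      using that by (intro ext add) (simp_all add: mem abelian_monoid.a_comm[OF mon])
  qed (rule add zero | assumption | (rule ext; (intro add zero)?; simp add: mem))+
  show "(a \<oplus> b) \<odot>\<^bsub>?D\<^esub> x = a \<odot>\<^bsub>?D\<^esub> x \<oplus>\<^bsub>?D\<^esub> b \<odot>\<^bsub>?D\<^esub> x"
    "(a \<otimes> b) \<odot>\<^bsub>?D\<^esub> x = a \<odot>\<^bsub>?D\<^esub> (b \<odot>\<^bsub>?D\<^esub> x)"
    if "a \<in> carrier R" "b \<in> carrier R" "x \<in> carrier ?D" for a b x
    using that by (intro ext add smult m_closed a_closed; simp add: mem)+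
  show "a \<odot>\<^bsub>?D\<^esub> (x \<oplus>\<^bsub>?D\<^esub> y) = a \<odot>\<^bsub>?D\<^esub> x \<oplus>\<^bsub>?D\<^esub> a \<odot>\<^bsub>?D\<^esub> y"
    if "a \<in> carrier R" "x \<in> carrier ?D" "y \<in> carrier ?D" for a x y
    using that by (intro ext add smult; simp add: mem)
  show "\<one> \<odot>\<^bsub>?D\<^esub> x = x" if "x \<in> carrier ?D" for x
    using that by (intro ext smult) (simp_all add: mem)
qed (rule cring_axioms)

lemma (in cring) free_module_map_closed:
  assumes "p \<in> S \<rightarrow> T" "x \<in> carrier (free_module R S)"
  shows "free_module_map R S T p x \<in> carrier (free_module R T)"
proof -
  let ?y = "free_module_map R S T p x"
  have "{t \<in> T. ?y t \<noteq> \<zero>} \<subseteq> p ` {s \<in> S. x s \<noteq> \<zero>}"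
  proof
    fix t assume t: "t \<in> {t \<in> T. ?y t \<noteq> \<zero>}"
    then have "{s \<in> S. x s \<noteq> \<zero> \<and> p s = t} \<noteq> {}"
      by (auto simp: free_module_map_def simp del: Collect_empty_eq split: if_splits)
    then show "t \<in> p ` {s \<in> S. x s \<noteq> \<zero>}" by auto
  qed
  then have "finite {t \<in> T. ?y t \<noteq> \<zero>}"
    using assms(2) by (auto simp: free_module_simps intro: finite_subset)
  moreover have "?y t \<in> carrier R" for t
    using free_module_in_carrier[OF assms(2)]
    by (auto simp: free_module_map_def intro!: finsum_closed)
  moreover have "?y t = \<zero>" if "t \<notin> T" for t
    using that by (simp add: free_module_map_def)
  ultimately show ?thesis
    by (simp add: free_module_simps)
qed

section \<open>Maps out of finite sums of free modules, and criteria for finite generation\<close>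

lemma nat_transD:
  assumes "nat_trans C A M N \<phi>"
  shows "c \<in> Obj C \<Longrightarrow> \<phi> c \<in> module_hom A (at_obj M c) (at_obj N c)"
    and "\<lbrakk>c \<in> Obj C; d \<in> Obj C; f \<in> Hom C c d; x \<in> carrier (at_obj M c)\<rbrakk>
      \<Longrightarrow> \<phi> d (at_hom M c d f x) = at_hom N c d f (\<phi> c x)"
  using assms by (auto simp: nat_trans_def)

context cat_module
begin

lemma at_hom_closed:
  "\<lbrakk>c \<in> Obj C; d \<in> Obj C; f \<in> Hom C c d; x \<in> carrier (at_obj M c)\<rbrakk>
    \<Longrightarrow> at_hom M c d f x \<in> carrier (at_obj M d)"
  using module_hom_closed[OF hom_at_hom] .

text \<open>Yoneda: \<open>x\<close> determines the map that sends the basis element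
  \<open>g\<close> to the transport of \<open>x\<close> along \<open>g\<close>. The sum may run over
  the whole Hom-set because that set is finite.\<close>

lemma nat_trans_free_cmod:
  assumes fin: "\<And>c. c \<in> Obj C \<Longrightarrow> finite (Hom C b c)"
    and b: "b \<in> Obj C" and x: "x \<in> carrier (at_obj M b)"
  shows "nat_trans C A (free_cmod C A b) M
    (\<lambda>c z. \<Oplus>\<^bsub>at_obj M c\<^esub>g\<in>Hom C b c. z g \<odot>\<^bsub>at_obj M c\<^esub> at_hom M b c g x)"
  unfolding nat_trans_def
proof (intro conjI ballI)
  let ?F = "\<lambda>c. free_module A (Hom C b c)"
  let ?e = "\<lambda>c g. at_hom M b c g x"
  let ?\<psi> = "\<lambda>c z. \<Oplus>\<^bsub>at_obj M c\<^esub>g\<in>Hom C b c. z g \<odot>\<^bsub>at_obj M c\<^esub> ?e c g"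
  have e: "?e c \<in> Hom C b c \<rightarrow> carrier (at_obj M c)" if "c \<in> Obj C" for c
    using at_hom_closed b x that by blast
  fix c assume c: "c \<in> Obj C"
  interpret Mc: module A "at_obj M c" by (rule module_at_obj[OF c])
  have ze: "(\<lambda>g. z g \<odot>\<^bsub>at_obj M c\<^esub> ?e c g) \<in> Hom C b c \<rightarrow> carrier (at_obj M c)"
    if "z \<in> carrier (?F c)" for z
    using e[OF c] free_module_in_carrier[OF that] by auto
  show "?\<psi> c \<in> module_hom A (at_obj (free_cmod C A b) c) (at_obj M c)"
    unfolding module_hom_def hom_def
  proof (intro CollectI conjI ballI funcsetI; (simp add: free_cmod_def)?)
    show "?\<psi> c z \<in> carrier (at_obj M c)" if "z \<in> carrier (?F c)" for z
      using ze[OF that] by (rule Mc.M.finsum_closed)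
    show "?\<psi> c (z \<oplus>\<^bsub>?F c\<^esub> w) = ?\<psi> c z \<oplus>\<^bsub>at_obj M c\<^esub> ?\<psi> c w"
      if z: "z \<in> carrier (?F c)" and w: "w \<in> carrier (?F c)" for z w
    proof -
      have "?\<psi> c (z \<oplus>\<^bsub>?F c\<^esub> w)
          = (\<Oplus>\<^bsub>at_obj M c\<^esub>g\<in>Hom C b c. z g \<odot>\<^bsub>at_obj M c\<^esub> ?e c g \<oplus>\<^bsub>at_obj M c\<^esub> w g \<odot>\<^bsub>at_obj M c\<^esub> ?e c g)"
        using e[OF c] free_module_in_carrier[OF z] free_module_in_carrier[OF w]
        by (intro Mc.M.finsum_cong') (auto simp: free_module_simps Mc.smult_l_distr Pi_def)
      also have "\<dots> = ?\<psi> c z \<oplus>\<^bsub>at_obj M c\<^esub> ?\<psi> c w"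
        using ze[OF z] ze[OF w] by (rule Mc.M.finsum_addf)
      finally show ?thesis .
    qed
    show "?\<psi> c (a \<odot>\<^bsub>?F c\<^esub> z) = a \<odot>\<^bsub>at_obj M c\<^esub> ?\<psi> c z"
      if a: "a \<in> carrier A" and z: "z \<in> carrier (?F c)" for a z
    proof -
      have "?\<psi> c (a \<odot>\<^bsub>?F c\<^esub> z)
          = (\<Oplus>\<^bsub>at_obj M c\<^esub>g\<in>Hom C b c. a \<odot>\<^bsub>at_obj M c\<^esub> (z g \<odot>\<^bsub>at_obj M c\<^esub> ?e c g))"
        using e[OF c] free_module_in_carrier[OF z] a
        by (intro Mc.M.finsum_cong') (auto simp: free_module_simps Mc.smult_assoc1 Pi_def)
      also have "\<dots> = a \<odot>\<^bsub>at_obj M c\<^esub> ?\<psi> c z"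
        using Mc.finsum_smult_ldistr[OF fin[OF c] a ze[OF z]] by simp
      finally show ?thesis .
    qed
  qed
  fix d f z assume d: "d \<in> Obj C" and f: "f \<in> Hom C c d"
    and z': "z \<in> carrier (at_obj (free_cmod C A b) c)"
  interpret Md: module A "at_obj M d" by (rule module_at_obj[OF d])
  have z: "z \<in> carrier (?F c)" using z' by (simp add: free_cmod_def)
  let ?p = "Comp C b c d f"
  have p: "?p \<in> Hom C b c \<rightarrow> Hom C b d"
    using Comp_in_Hom[OF b c d _ f] by blast
  \<comment> \<open>The push along \<open>f\<close> collects coefficients over the fibres of
    postcomposition; functoriality of \<open>M\<close> then splits off the action of
    \<open>f\<close>, and linearity moves it out of the sum.\<close>
  have "?\<psi> d (at_hom (free_cmod C A b) c d f z)
      = (\<Oplus>\<^bsub>at_obj M d\<^esub>g'\<in>Hom C b d.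
          (\<Oplus>g\<in>{g \<in> Hom C b c. z g \<noteq> \<zero> \<and> ?p g = g'}. z g) \<odot>\<^bsub>at_obj M d\<^esub> ?e d g')"
    using e[OF d] free_module_in_carrier[OF z]
    by (intro Md.M.finsum_cong') (auto simp: free_cmod_def free_module_map_def Pi_def intro!: finsum_closed)
  also have "\<dots> = (\<Oplus>\<^bsub>at_obj M d\<^esub>g\<in>Hom C b c. z g \<odot>\<^bsub>at_obj M d\<^esub> ?e d (?p g))"
    using free_module_in_carrier[OF z] by (intro Md.finsum_pushforward fin c d p e) auto
  also have "\<dots> = (\<Oplus>\<^bsub>at_obj M d\<^esub>g\<in>Hom C b c. at_hom M c d f (z g \<odot>\<^bsub>at_obj M c\<^esub> ?e c g))"
    using free_module_in_carrier[OF z] e[OF c] at_hom_closed[OF c d f]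
    by (intro Md.M.finsum_cong')
      (auto simp: Pi_def at_hom_Comp[OF b c d _ f x] module_hom_smult[OF hom_at_hom[OF c d f]])
  also have "\<dots> = at_hom M c d f (?\<psi> c z)"
    using module_hom_finsum[OF module_at_obj[OF c] module_at_obj[OF d] hom_at_hom[OF c d f] fin[OF c] ze[OF z]]
    by simp
  finally show "?\<psi> d (at_hom (free_cmod C A b) c d f z) = at_hom M c d f (?\<psi> c z)" .
qed

lemma nat_trans_direct_sum_cmod:
  assumes I: "finite I" and \<psi>: "\<And>i. i \<in> I \<Longrightarrow> nat_trans C A (F i) M (\<psi> i)"
  shows "nat_trans C A (direct_sum_cmod I F) M (\<lambda>c z. \<Oplus>\<^bsub>at_obj M c\<^esub>i\<in>I. \<psi> i c (z i))"
  unfolding nat_trans_def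
proof (intro conjI ballI)
  let ?D = "\<lambda>c. direct_sum_module I (\<lambda>i. at_obj (F i) c)"
  let ?\<psi> = "\<lambda>c z. \<Oplus>\<^bsub>at_obj M c\<^esub>i\<in>I. \<psi> i c (z i)"
  note \<psi>1 = nat_transD(1)[OF \<psi>]
  fix c assume c: "c \<in> Obj C"
  interpret Mc: module A "at_obj M c" by (rule module_at_obj[OF c])
  have mem: "z i \<in> carrier (at_obj (F i) c)" if "z \<in> carrier (?D c)" "i \<in> I" for z i
    using that by (auto simp: direct_sum_module_simps)
  have cl: "(\<lambda>i. \<psi> i c (z i)) \<in> I \<rightarrow> carrier (at_obj M c)" if "z \<in> carrier (?D c)" for z
    using module_hom_closed[OF \<psi>1[OF _ c] mem[OF that]] by blast
  show "?\<psi> c \<in> module_hom A (at_obj (direct_sum_cmod I F) c) (at_obj M c)"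
    unfolding module_hom_def hom_def
  proof (intro CollectI conjI ballI funcsetI; (simp add: direct_sum_cmod_def)?)
    show "?\<psi> c z \<in> carrier (at_obj M c)" if "z \<in> carrier (?D c)" for z
      using cl[OF that] by (rule Mc.M.finsum_closed)
    show "?\<psi> c (z \<oplus>\<^bsub>?D c\<^esub> w) = ?\<psi> c z \<oplus>\<^bsub>at_obj M c\<^esub> ?\<psi> c w"
      if z: "z \<in> carrier (?D c)" and w: "w \<in> carrier (?D c)" for z w
    proof -
      have "?\<psi> c (z \<oplus>\<^bsub>?D c\<^esub> w) = (\<Oplus>\<^bsub>at_obj M c\<^esub>i\<in>I. \<psi> i c (z i) \<oplus>\<^bsub>at_obj M c\<^esub> \<psi> i c (w i))"
        using cl[OF z] cl[OF w]
        by (intro Mc.M.finsum_cong')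
          (auto simp: direct_sum_module_simps(3) Pi_def module_hom_add[OF \<psi>1[OF _ c] mem[OF z] mem[OF w]])
      also have "\<dots> = ?\<psi> c z \<oplus>\<^bsub>at_obj M c\<^esub> ?\<psi> c w"
        using cl[OF z] cl[OF w] by (rule Mc.M.finsum_addf)
      finally show ?thesis .
    qed
    show "?\<psi> c (a \<odot>\<^bsub>?D c\<^esub> z) = a \<odot>\<^bsub>at_obj M c\<^esub> ?\<psi> c z"
      if a: "a \<in> carrier A" and z: "z \<in> carrier (?D c)" for a z
    proof -
      have "?\<psi> c (a \<odot>\<^bsub>?D c\<^esub> z) = (\<Oplus>\<^bsub>at_obj M c\<^esub>i\<in>I. a \<odot>\<^bsub>at_obj M c\<^esub> \<psi> i c (z i))"
        using cl[OF z] a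
        by (intro Mc.M.finsum_cong')
          (auto simp: direct_sum_module_simps(4) Pi_def module_hom_smult[OF \<psi>1[OF _ c] a mem[OF z]])
      also have "\<dots> = a \<odot>\<^bsub>at_obj M c\<^esub> ?\<psi> c z"
        using Mc.finsum_smult_ldistr[OF I a cl[OF z]] by simp
      finally show ?thesis .
    qed
  qed
  fix d f z assume d: "d \<in> Obj C" and f: "f \<in> Hom C c d"
    and z': "z \<in> carrier (at_obj (direct_sum_cmod I F) c)"
  interpret Md: module A "at_obj M d" by (rule module_at_obj[OF d])
  have z: "z \<in> carrier (?D c)" using z' by (simp add: direct_sum_cmod_def)
  have "?\<psi> d (at_hom (direct_sum_cmod I F) c d f z) = (\<Oplus>\<^bsub>at_obj M d\<^esub>i\<in>I. at_hom M c d f (\<psi> i c (z i)))"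
    using at_hom_closed[OF c d f] cl[OF z]
    by (intro Md.M.finsum_cong')
      (auto simp: direct_sum_cmod_def Pi_def nat_transD(2)[OF \<psi> c d f mem[OF z]])
  also have "\<dots> = at_hom M c d f (?\<psi> c z)"
    using module_hom_finsum[OF module_at_obj[OF c] module_at_obj[OF d] hom_at_hom[OF c d f] I cl[OF z]]
    by simp
  finally show "?\<psi> d (at_hom (direct_sum_cmod I F) c d f z) = at_hom M c d f (?\<psi> c z)" .
qed

text \<open>\<open>P\<close> enters only through its modules and through transition maps that stay
  inside them, so finite sums of free modules can be used without first showing that they are
  functors.\<close>

lemma sub_cmod_image:
  assumes P: "\<And>c. c \<in> Obj C \<Longrightarrow> module A (at_obj P c)"
    and P_hom: "\<And>c d f z. \<lbrakk>c \<in> Obj C; d \<in> Obj C; f \<in> Hom C c d; z \<in> carrier (at_obj P c)\<rbrakk>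
      \<Longrightarrow> at_hom P c d f z \<in> carrier (at_obj P d)"
    and \<phi>: "nat_trans C A P M \<phi>"
  shows "sub_cmod C A M (\<lambda>c. \<phi> c ` carrier (at_obj P c))"
  unfolding sub_cmod_def
proof (intro conjI ballI)
  fix c assume c: "c \<in> Obj C"
  interpret Mc: module A "at_obj M c" by (rule module_at_obj[OF c])
  interpret Pc: module A "at_obj P c" by (rule P[OF c])
  note h = nat_transD(1)[OF \<phi> c]
  note cl = module_hom_closed[OF h]
  show "submodule (\<phi> c ` carrier (at_obj P c)) A (at_obj M c)"
  proof (rule Mc.submoduleI)
    show "\<phi> c ` carrier (at_obj P c) \<subseteq> carrier (at_obj M c)"
      using cl by blast
    show "\<zero>\<^bsub>at_obj M c\<^esub> \<in> \<phi> c ` carrier (at_obj P c)"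
      using imageI[OF Pc.M.zero_closed, of "\<phi> c"]
      by (simp only: module_hom_zero[OF P[OF c] module_at_obj[OF c] h])
    show smult: "a \<odot>\<^bsub>at_obj M c\<^esub> x \<in> \<phi> c ` carrier (at_obj P c)"
      if a: "a \<in> carrier A" and x: "x \<in> \<phi> c ` carrier (at_obj P c)" for a x
    proof -
      obtain z where z: "z \<in> carrier (at_obj P c)" "x = \<phi> c z" using x by (rule imageE) simp
      show ?thesis
        using imageI[OF Pc.smult_closed[OF a z(1)], of "\<phi> c"] by (simp only: z(2) module_hom_smult[OF h a z(1)])
    qed
    show "\<ominus>\<^bsub>at_obj M c\<^esub> x \<in> \<phi> c ` carrier (at_obj P c)"
      if x: "x \<in> \<phi> c ` carrier (at_obj P c)" for x
    proof -
      have "x \<in> carrier (at_obj M c)" using x cl by blast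
      then have "(\<ominus> \<one>) \<odot>\<^bsub>at_obj M c\<^esub> x = \<ominus>\<^bsub>at_obj M c\<^esub> x"
        by (simp add: Mc.smult_l_minus)
      then show ?thesis using smult[OF _ x, of "\<ominus> \<one>"] by simp
    qed
    show "x \<oplus>\<^bsub>at_obj M c\<^esub> y \<in> \<phi> c ` carrier (at_obj P c)"
      if x: "x \<in> \<phi> c ` carrier (at_obj P c)" and y: "y \<in> \<phi> c ` carrier (at_obj P c)" for x y
    proof -
      obtain z where z: "z \<in> carrier (at_obj P c)" "x = \<phi> c z" using x by (rule imageE) simp
      obtain w where w: "w \<in> carrier (at_obj P c)" "y = \<phi> c w" using y by (rule imageE) simp
      show ?thesis
        using imageI[OF Pc.M.a_closed[OF z(1) w(1)], of "\<phi> c"]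
        by (simp only: z(2) w(2) module_hom_add[OF h z(1) w(1)])
    qed
  qed
  fix d f assume d: "d \<in> Obj C" and f: "f \<in> Hom C c d"
  have "at_hom M c d f (\<phi> c z) \<in> \<phi> d ` carrier (at_obj P d)" if z: "z \<in> carrier (at_obj P c)" for z
    using imageI[OF P_hom[OF c d f z], of "\<phi> d"] by (simp only: nat_transD(2)[OF \<phi> c d f z])
  then show "at_hom M c d f ` \<phi> c ` carrier (at_obj P c) \<subseteq> \<phi> d ` carrier (at_obj P d)"
    by blast
qed

text \<open>\<open>gen\<close> says that no proper submodule contains \<open>E\<close>. The map
  sending the \<open>i\<close>-th free generator to the \<open>i\<close>-th element of
  \<open>E\<close> has as image a submodule containing \<open>E\<close>, hence everything; linear
  combinations never have to be written out.\<close>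

lemma finitely_generatedI:
  assumes fin: "\<And>c d. c \<in> Obj C \<Longrightarrow> d \<in> Obj C \<Longrightarrow> finite (Hom C c d)"
    and E: "finite E" "\<And>b x. (b, x) \<in> E \<Longrightarrow> b \<in> Obj C \<and> x \<in> carrier (at_obj M b)"
    and gen: "\<And>S c. \<lbrakk>sub_cmod C A M S; \<And>b x. (b, x) \<in> E \<Longrightarrow> x \<in> S b; c \<in> Obj C\<rbrakk>
      \<Longrightarrow> carrier (at_obj M c) \<subseteq> S c"
  shows "finitely_generated C A M"
proof -
  obtain xs where xs: "set xs = E" using finite_list[OF E(1)] by blast
  define n b x where "n = length xs" and "b = (\<lambda>i. fst (xs ! i))" and "x = (\<lambda>i. snd (xs ! i))"
  have bx: "(b i, x i) \<in> E" if "i < n" for i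
    using that nth_mem[of i xs] by (simp add: n_def b_def x_def xs)
  have b: "b i \<in> Obj C" and x: "x i \<in> carrier (at_obj M (b i))" if "i < n" for i
    using E(2)[OF bx[OF that]] by auto
  let ?P = "direct_sum_cmod {..<n} (\<lambda>i. free_cmod C A (b i))"
  define \<psi> where "\<psi> i c z = (\<Oplus>\<^bsub>at_obj M c\<^esub>g\<in>Hom C (b i) c. z g \<odot>\<^bsub>at_obj M c\<^esub> at_hom M (b i) c g (x i))"
    for i c z
  define \<Psi> where "\<Psi> c z = (\<Oplus>\<^bsub>at_obj M c\<^esub>i\<in>{..<n}. \<psi> i c (z i))" for c z
  have \<psi>: "nat_trans C A (free_cmod C A (b i)) M (\<psi> i)" if "i < n" for i
    using nat_trans_free_cmod[OF fin[OF b[OF that]] b[OF that] x[OF that]] by (simp add: \<psi>_def[abs_def])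
  have nt: "nat_trans C A ?P M \<Psi>"
    using nat_trans_direct_sum_cmod[OF finite_lessThan, of n "\<lambda>i. free_cmod C A (b i)" \<psi>] \<psi>
    by (simp add: \<Psi>_def[abs_def])
  have P: "at_obj ?P c = direct_sum_module {..<n} (\<lambda>i. free_module A (Hom C (b i) c))" for c
    by (simp add: direct_sum_cmod_def free_cmod_def)
  have sub: "sub_cmod C A M (\<lambda>c. \<Psi> c ` carrier (at_obj ?P c))"
  proof (rule sub_cmod_image[OF _ _ nt])
    show "module A (at_obj ?P c)" for c
      unfolding P by (intro module_direct_sum_module module_free_module)
    show "at_hom ?P c d f z \<in> carrier (at_obj ?P d)"
      if c: "c \<in> Obj C" and d: "d \<in> Obj C" and f: "f \<in> Hom C c d"
        and z: "z \<in> carrier (at_obj ?P c)" for c d f z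
    proof -
      have "free_module_map A (Hom C (b i) c) (Hom C (b i) d) (Comp C (b i) c d f) (z i)
          \<in> carrier (free_module A (Hom C (b i) d))" if "i < n" for i
        using z that Comp_in_Hom[OF b[OF that] c d _ f]
        by (intro free_module_map_closed) (auto simp: P direct_sum_module_simps)
      then show ?thesis
        by (simp add: P direct_sum_module_simps(1)) (simp add: direct_sum_cmod_def free_cmod_def)
    qed
  qed
  have x_image: "x i \<in> \<Psi> (b i) ` carrier (at_obj ?P (b i))" if i: "i < n" for i
  proof
    interpret Mb: module A "at_obj M (b i)" by (rule module_at_obj[OF b[OF i]])
    \<comment> \<open>The basis vector at the identity of \<open>b i\<close> in summand
      \<open>i\<close>. Its image is the transport of \<open>x i\<close> along the identity, that
      is, \<open>x i\<close>.\<close>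
    define \<delta> where "\<delta> = (\<lambda>j\<in>{..<n}. \<lambda>g. if j = i \<and> g = Id C (b i) then \<one> else \<zero>)"
    have "{g \<in> Hom C (b j) (b i). \<delta> j g \<noteq> \<zero>} \<subseteq> {Id C (b i)}" if "j < n" for j
      using that by (auto simp: \<delta>_def split: if_splits)
    then have fin\<delta>: "finite {g \<in> Hom C (b j) (b i). \<delta> j g \<noteq> \<zero>}" if "j < n" for j
      using that finite_subset by blast
    show "\<delta> \<in> carrier (at_obj ?P (b i))"
      using fin\<delta> Id_in_Hom[OF b[OF i]]
      by (auto simp: P direct_sum_module_simps free_module_simps) (auto simp: \<delta>_def)
    have zero: "\<psi> j (b i) (\<lambda>g. \<zero>) = \<zero>\<^bsub>at_obj M (b i)\<^esub>" if "j < n" for j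
    proof -
      have "\<psi> j (b i) \<in> module_hom A (free_module A (Hom C (b j) (b i))) (at_obj M (b i))"
        using nat_transD(1)[OF \<psi>[OF that] b[OF i]] by (simp add: free_cmod_def)
      from module_hom_zero[OF module_free_module module_at_obj[OF b[OF i]] this]
      show ?thesis by (simp add: free_module_simps)
    qed
    have e: "at_hom M (b i) (b i) g (x i) \<in> carrier (at_obj M (b i))" if "g \<in> Hom C (b i) (b i)" for g
      using at_hom_closed[OF b[OF i] b[OF i] that x[OF i]] .
    have "\<psi> i (b i) (\<delta> i) = (\<Oplus>\<^bsub>at_obj M (b i)\<^esub>g\<in>Hom C (b i) (b i).
        if Id C (b i) = g then at_hom M (b i) (b i) g (x i) else \<zero>\<^bsub>at_obj M (b i)\<^esub>)"
      unfolding \<psi>_def using e i by (intro Mb.M.finsum_cong') (auto simp: \<delta>_def)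
    also have "\<dots> = at_hom M (b i) (b i) (Id C (b i)) (x i)"
      using e by (intro Mb.M.finsum_singleton Id_in_Hom fin b i) auto
    also have "\<dots> = x i" by (rule at_hom_Id[OF b[OF i] x[OF i]])
    finally have \<delta>i: "\<psi> i (b i) (\<delta> i) = x i" .
    have "\<Psi> (b i) \<delta> = (\<Oplus>\<^bsub>at_obj M (b i)\<^esub>j\<in>{..<n}. if i = j then x i else \<zero>\<^bsub>at_obj M (b i)\<^esub>)"
      unfolding \<Psi>_def using zero \<delta>i x[OF i]
      by (intro Mb.M.finsum_cong') (auto simp: \<delta>_def)
    also have "\<dots> = x i"
      using i x[OF i] by (intro Mb.M.finsum_singleton[where f = "\<lambda>_. x i"]) auto
    finally show "x i = \<Psi> (b i) \<delta>" by simp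
  qed
  have "y \<in> \<Psi> d ` carrier (at_obj ?P d)" if dy: "(d, y) \<in> E" for d y
  proof -
    obtain i where "i < n" "xs ! i = (d, y)"
      using dy unfolding n_def xs[symmetric] in_set_conv_nth by blast
    then show ?thesis using x_image[of i] by (simp add: b_def x_def)
  qed
  then have "carrier (at_obj M c) \<subseteq> \<Psi> c ` carrier (at_obj ?P c)" if "c \<in> Obj C" for c
    using gen[OF sub _ that] by blast
  moreover have "\<Psi> c ` carrier (at_obj ?P c) \<subseteq> carrier (at_obj M c)" if "c \<in> Obj C" for c
    using module_hom_closed[OF nat_transD(1)[OF nt that]] by blast
  ultimately have "surjection C A ?P M \<Psi>"
    using nt unfolding surjection_def by blast
  then show ?thesis
    unfolding finitely_generated_def using b by blast
qed

lemma cat_module_restrict: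
  assumes N: "sub_cmod C A M N"
  shows "cat_module C A (restrict_cmod M N)"
proof -
  have sub: "N c \<subseteq> carrier (at_obj M c)" if "c \<in> Obj C" for c
    using module.submoduleE(1)[OF module_at_obj[OF that]] N that by (auto simp: sub_cmod_def)
  have cl: "at_hom M c d f x \<in> N d" if "c \<in> Obj C" "d \<in> Obj C" "f \<in> Hom C c d" "x \<in> N c" for c d f x
    using N that unfolding sub_cmod_def by blast
  have R: "at_obj (restrict_cmod M N) = (\<lambda>c. (at_obj M c)\<lparr>carrier := N c\<rparr>)"
    "at_hom (restrict_cmod M N) = at_hom M"
    by (simp_all add: restrict_cmod_def)
  show ?thesis
  proof (intro cat_module.intro cat_module_axioms.intro category_axioms cring_axioms, unfold R)
    show "module A (at_obj M c\<lparr>carrier := N c\<rparr>)" if "c \<in> Obj C" for c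
      using N that submodule.submodule_is_module[OF _ module_at_obj[OF that]]
      by (simp add: sub_cmod_def)
    show "at_hom M c d f \<in> module_hom A (at_obj M c\<lparr>carrier := N c\<rparr>) (at_obj M d\<lparr>carrier := N d\<rparr>)"
      if "c \<in> Obj C" "d \<in> Obj C" "f \<in> Hom C c d" for c d f
      using cl[OF that] sub[OF that(1)] module_hom_add[OF hom_at_hom[OF that]]
        module_hom_smult[OF hom_at_hom[OF that]]
      by (auto simp: module_hom_def hom_def subset_iff)
    show "at_hom M c c (Id C c) x = x" if "c \<in> Obj C" "x \<in> carrier (at_obj M c\<lparr>carrier := N c\<rparr>)" for c x
      using at_hom_Id[OF that(1)] sub[OF that(1)] that(2) by auto
    show "at_hom M c e (Comp C c d e g f) x = at_hom M d e g (at_hom M c d f x)"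
      if "c \<in> Obj C" "d \<in> Obj C" "e \<in> Obj C" "f \<in> Hom C c d" "g \<in> Hom C d e"
        "x \<in> carrier (at_obj M c\<lparr>carrier := N c\<rparr>)" for c d e f g x
      using at_hom_Comp[OF that(1-5)] sub[OF that(1)] that(6) by auto
  qed
qed

text \<open>A submodule of the restriction of \<open>M\<close> to \<open>N\<close> is also a
  submodule of \<open>M\<close>, so generation of \<open>N\<close> can be tested inside the ambient
  module.\<close>

lemma finitely_generated_restrictI:
  assumes fin: "\<And>c d. c \<in> Obj C \<Longrightarrow> d \<in> Obj C \<Longrightarrow> finite (Hom C c d)"
    and N: "sub_cmod C A M N"
    and E: "finite E" "\<And>b x. (b, x) \<in> E \<Longrightarrow> b \<in> Obj C \<and> x \<in> N b"
    and gen: "\<And>S c. \<lbrakk>sub_cmod C A M S; \<And>b x. (b, x) \<in> E \<Longrightarrow> x \<in> S b; c \<in> Obj C\<rbrakk> \<Longrightarrow> N c \<subseteq> S c"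
  shows "finitely_generated C A (restrict_cmod M N)"
proof (rule cat_module.finitely_generatedI[OF cat_module_restrict[OF N] fin E(1)])
  show "b \<in> Obj C \<and> x \<in> carrier (at_obj (restrict_cmod M N) b)" if "(b, x) \<in> E" for b x
    using E(2)[OF that] by (simp add: restrict_cmod_def)
  show "carrier (at_obj (restrict_cmod M N) c) \<subseteq> S c"
    if S: "sub_cmod C A (restrict_cmod M N) S" and "\<And>b x. (b, x) \<in> E \<Longrightarrow> x \<in> S b" "c \<in> Obj C" for S c
  proof -
    have "submodule (S d) A (at_obj M d)" if d: "d \<in> Obj C" for d
    proof -
      have NS: "submodule (N d) A (at_obj M d)" "submodule (S d) A (at_obj M d\<lparr>carrier := N d\<rparr>)"
        using N S d by (simp_all add: sub_cmod_def restrict_cmod_def)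
      interpret Md: module A "at_obj M d" by (rule module_at_obj[OF d])
      have m: "module A (at_obj M d\<lparr>carrier := N d\<rparr>)"
        by (rule submodule.submodule_is_module[OF NS(1) module_at_obj[OF d]])
      have "module A (at_obj M d\<lparr>carrier := S d\<rparr>)"
        using submodule.submodule_is_module[OF NS(2) m] by simp
      moreover have "S d \<subseteq> carrier (at_obj M d)"
        using module.submoduleE(1)[OF m NS(2)] Md.submoduleE(1)[OF NS(1)] by simp
      ultimately show ?thesis by (intro Md.module_incl_imp_submodule)
    qed
    then have "sub_cmod C A M S"
      using S by (simp add: sub_cmod_def restrict_cmod_def)
    from gen[OF this that(2,3)] show ?thesis
      by (simp add: restrict_cmod_def)
  qed
qed

end

section \<open>Leading coefficients\<close>

text \<open>The ideals form a nonempty chain, and in a Noetherian ring the union of such a chain is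
  one of its members.\<close>

lemma (in noetherian_ring) ideal_sequence_stabilizes:
  assumes I: "\<And>k::nat. ideal (I k) R" and mono: "\<And>k. I k \<subseteq> I (Suc k)"
  shows "\<exists>k. I (Suc k) \<subseteq> I k"
proof -
  have le: "I j \<subseteq> I k" if "j \<le> k" for j k
    using mono that by (rule lift_Suc_mono_le)
  have "\<Union> (range I) \<in> range I"
  proof (rule ideal_chain_is_trivial)
    have "I j \<subseteq> I k \<or> I k \<subseteq> I j" for j k
      using le[of j k] le[of k j] by linarith
    then show "subset.chain {I. ideal I R} (range I)"
      using I by (auto simp: subset_chain_def)
  qed simp
  then obtain k where "\<Union> (range I) = I k" by blast
  then show ?thesis by blast
qed

text \<open>Fibres of an injective \<open>p\<close> have at most one element, so no coefficients are
  added up. This lets a leading coefficient pass unchanged to another object.\<close>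

lemma (in cring) free_module_map_apply_inj:
  assumes p: "inj_on p S" "p \<in> S \<rightarrow> T" and s: "s \<in> S" and x: "x \<in> carrier (free_module R S)"
  shows "free_module_map R S T p x (p s) = x s"
proof (cases "x s = \<zero>")
  case True
  then have "{s' \<in> S. x s' \<noteq> \<zero> \<and> p s' = p s} = {}"
    using p(1) s by (auto dest: inj_onD)
  then show ?thesis using p s True by (simp add: free_module_map_def del: Collect_empty_eq)
next
  case False
  then have "{s' \<in> S. x s' \<noteq> \<zero> \<and> p s' = p s} = {s}"
    using p(1) s by (auto dest: inj_onD)
  then show ?thesis
    using p s free_module_in_carrier[OF x] by (auto simp: free_module_map_def)
qed

lemma (in cring) free_module_map_support:
  assumes "free_module_map R S T p x t \<noteq> \<zero>"
  obtains s where "s \<in> S" "x s \<noteq> \<zero>" "p s = t"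
proof -
  have "{s \<in> S. x s \<noteq> \<zero> \<and> p s = t} \<noteq> {}"
    using assms by (auto simp: free_module_map_def simp del: Collect_empty_eq split: if_splits)
  then show thesis using that by blast
qed

text \<open>Given as an intersection of submodules, which makes minimality and monotonicity
  immediate. The explicit carrier bounds it even when no submodule contains
  \<open>E\<close>.\<close>

definition generated_sub ::
  "('o, 'm) cat \<Rightarrow> ('a, 'r) ring_scheme \<Rightarrow> ('o, 'm, 'a, 'x) cmod \<Rightarrow> ('o \<times> 'x) set \<Rightarrow> 'o \<Rightarrow> 'x set" where
  "generated_sub C A M E c =
    {x \<in> carrier (at_obj M c). \<forall>S. sub_cmod C A M S \<and> (\<forall>(b, y)\<in>E. y \<in> S b) \<longrightarrow> x \<in> S c}"

lemma generated_sub_subset: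
  "\<lbrakk>sub_cmod C A M S; \<And>b y. (b, y) \<in> E \<Longrightarrow> y \<in> S b\<rbrakk> \<Longrightarrow> generated_sub C A M E c \<subseteq> S c"
  unfolding generated_sub_def by blast

lemma generated_sub_mono: "E \<subseteq> E' \<Longrightarrow> generated_sub C A M E c \<subseteq> generated_sub C A M E' c"
  unfolding generated_sub_def by blast

lemma generated_sub_base: "(c, x) \<in> E \<Longrightarrow> x \<in> carrier (at_obj M c) \<Longrightarrow> x \<in> generated_sub C A M E c"
  unfolding generated_sub_def by blast

context cat_module
begin

lemma sub_cmodD:
  assumes S: "sub_cmod C A M S" and c: "c \<in> Obj C"
  shows "S c \<subseteq> carrier (at_obj M c)"
    and "\<zero>\<^bsub>at_obj M c\<^esub> \<in> S c"
    and "\<And>x y. x \<in> S c \<Longrightarrow> y \<in> S c \<Longrightarrow> x \<oplus>\<^bsub>at_obj M c\<^esub> y \<in> S c"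
    and "\<And>x. x \<in> S c \<Longrightarrow> \<ominus>\<^bsub>at_obj M c\<^esub> x \<in> S c"
    and "\<And>a x. a \<in> carrier A \<Longrightarrow> x \<in> S c \<Longrightarrow> a \<odot>\<^bsub>at_obj M c\<^esub> x \<in> S c"
    and "\<And>d f x. d \<in> Obj C \<Longrightarrow> f \<in> Hom C c d \<Longrightarrow> x \<in> S c \<Longrightarrow> at_hom M c d f x \<in> S d"
proof -
  interpret Mc: module A "at_obj M c" by (rule module_at_obj[OF c])
  have sub: "submodule (S c) A (at_obj M c)" using S c by (simp add: sub_cmod_def)
  note E = Mc.submoduleE[OF sub]
  show "S c \<subseteq> carrier (at_obj M c)" by (rule E(1))
  obtain x where "x \<in> S c" using E(2) by blast
  then show "\<zero>\<^bsub>at_obj M c\<^esub> \<in> S c"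
    using E(4)[OF zero_closed] E(1) by (metis Mc.smult_l_null subsetD)
  show "x \<oplus>\<^bsub>at_obj M c\<^esub> y \<in> S c" if "x \<in> S c" "y \<in> S c" for x y using that by (rule E(5))
  show "\<ominus>\<^bsub>at_obj M c\<^esub> x \<in> S c" if "x \<in> S c" for x using that by (rule E(3))
  show "a \<odot>\<^bsub>at_obj M c\<^esub> x \<in> S c" if "a \<in> carrier A" "x \<in> S c" for a x using that by (rule E(4))
  show "at_hom M c d f x \<in> S d" if "d \<in> Obj C" "f \<in> Hom C c d" "x \<in> S c" for d f x
    using S c that unfolding sub_cmod_def by blast
qed

lemma sub_cmod_generated_sub: "sub_cmod C A M (generated_sub C A M E)"
  unfolding sub_cmod_def
proof (intro conjI ballI)
  fix c assume c: "c \<in> Obj C"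
  interpret Mc: module A "at_obj M c" by (rule module_at_obj[OF c])
  show "submodule (generated_sub C A M E c) A (at_obj M c)"
    by (rule Mc.submoduleI) (auto simp: generated_sub_def intro: sub_cmodD[OF _ c])
  fix d f assume d: "d \<in> Obj C" and f: "f \<in> Hom C c d"
  show "at_hom M c d f ` generated_sub C A M E c \<subseteq> generated_sub C A M E d"
    using at_hom_closed[OF c d f] sub_cmodD(6)[OF _ c d f] by (auto simp: generated_sub_def)
qed

end

text \<open>\<open>T\<close> indexes objects with a chosen order, \<open>u\<close> forgets the
  order, and \<open>H s t\<close> consists of morphisms compatible with the orders.
  \<open>key t\<close> ranks the basis elements over \<open>u t\<close>; its values lie in one
  well-order for all \<open>t\<close>, so ranks over different objects compare. The last assumption
  concerns divisibility: one basis element divides another of the same summand if some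
  \<open>h\<close> in \<open>H s t\<close> carries the first to the second.\<close>

locale groebner_cover = category C for C :: "('o, 'm) cat" +
  fixes n :: nat and b :: "nat \<Rightarrow> 'o"
    and T :: "'t set" and u :: "'t \<Rightarrow> 'o" and H :: "'t \<Rightarrow> 't \<Rightarrow> 'm set"
    and key :: "'t \<Rightarrow> nat \<Rightarrow> 'm \<Rightarrow> 'k::wellorder"
  assumes finite_Hom: "\<And>c d. c \<in> Obj C \<Longrightarrow> d \<in> Obj C \<Longrightarrow> finite (Hom C c d)"
    and b_Obj: "\<And>i. i < n \<Longrightarrow> b i \<in> Obj C"
    and u_image: "u ` T = Obj C"
    and H_subset: "\<And>s t. s \<in> T \<Longrightarrow> t \<in> T \<Longrightarrow> H s t \<subseteq> Hom C (u s) (u t)"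
    and key_inj: "\<And>t i j f g. \<lbrakk>t \<in> T; i < n; j < n; f \<in> Hom C (b i) (u t); g \<in> Hom C (b j) (u t);
      key t i f = key t j g\<rbrakk> \<Longrightarrow> i = j \<and> f = g"
    and key_mono: "\<And>s t h i j f g. \<lbrakk>s \<in> T; t \<in> T; h \<in> H s t; i < n; j < n; f \<in> Hom C (b i) (u s);
      g \<in> Hom C (b j) (u s); key s i f < key s j g\<rbrakk>
      \<Longrightarrow> key t i (Comp C (b i) (u s) (u t) h f) < key t j (Comp C (b j) (u s) (u t) h g)"
    and wqo: "wqo_on (\<lambda>(s, i, f) (t, j, g). \<exists>h\<in>H s t. i = j \<and> Comp C (b i) (u s) (u t) h f = g)
      {(t, i, f). t \<in> T \<and> i < n \<and> f \<in> Hom C (b i) (u t)}"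
begin

lemma u_Obj: "t \<in> T \<Longrightarrow> u t \<in> Obj C"
  using u_image by blast

text \<open>Distinct basis elements have distinct keys, and \<open>h\<close> preserves strict
  inequality of keys, so their images cannot coincide.\<close>

lemma Comp_inj_on:
  assumes s: "s \<in> T" and t: "t \<in> T" and h: "h \<in> H s t" and i: "i < n"
  shows "inj_on (Comp C (b i) (u s) (u t) h) (Hom C (b i) (u s))"
proof (rule inj_onI, rule ccontr)
  fix f g assume fg: "f \<in> Hom C (b i) (u s)" "g \<in> Hom C (b i) (u s)"
    and eq: "Comp C (b i) (u s) (u t) h f = Comp C (b i) (u s) (u t) h g" and "f \<noteq> g"
  then have "key s i f \<noteq> key s i g" using key_inj[OF s i i] by blast
  then consider "key s i f < key s i g" | "key s i g < key s i f" by (rule linorder_neqE)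
  then show False
    using key_mono[OF s t h i i fg] key_mono[OF s t h i i fg(2,1)] by cases (simp_all add: eq)
qed

section \<open>The leading coefficient argument for a submodule of a presented module\<close>

context
  fixes A :: "('a, 'r) ring_scheme" (structure) and M :: "('o, 'm, 'a, 'x) cmod"
    and N :: "'o \<Rightarrow> 'x set"
    and \<phi> :: "'o \<Rightarrow> (nat \<Rightarrow> 'm \<Rightarrow> 'a) \<Rightarrow> 'x"
  assumes noeth: "noetherian_ring A" and M: "cat_module C A M"
    and \<phi>: "surjection C A (direct_sum_cmod {..<n} (\<lambda>i. free_cmod C A (b i))) M \<phi>"
    and N: "sub_cmod C A M N"
begin

interpretation M: cat_module C A M by (rule M)

definition P where "P = direct_sum_cmod {..<n} (\<lambda>i. free_cmod C A (b i))"

lemma at_obj_P: "at_obj P c = direct_sum_module {..<n} (\<lambda>i. free_module A (Hom C (b i) c))"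
  by (simp add: P_def direct_sum_cmod_def free_cmod_def)

lemma at_hom_P: "at_hom P c d f z = (\<lambda>i\<in>{..<n}.
    free_module_map A (Hom C (b i) c) (Hom C (b i) d) (Comp C (b i) c d f) (z i))"
  by (simp add: P_def direct_sum_cmod_def free_cmod_def)

lemma module_P: "module A (at_obj P c)"
  unfolding at_obj_P by (intro M.module_direct_sum_module M.module_free_module)

lemma P_component: "z \<in> carrier (at_obj P c) \<Longrightarrow> i < n \<Longrightarrow> z i \<in> carrier (free_module A (Hom C (b i) c))"
  by (auto simp: at_obj_P direct_sum_module_simps)

lemma P_coeff: "z \<in> carrier (at_obj P c) \<Longrightarrow> i < n \<Longrightarrow> z i g \<in> carrier A"
  using M.free_module_in_carrier[OF P_component] .

lemma P_ops:
  assumes "i < n"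
  shows "(z \<oplus>\<^bsub>at_obj P c\<^esub> w) i g = z i g \<oplus> w i g" "(a \<odot>\<^bsub>at_obj P c\<^esub> z) i g = a \<otimes> z i g"
  using assms by (simp_all add: at_obj_P direct_sum_module_simps free_module_simps)

lemma P_zeroI:
  assumes z: "z \<in> carrier (at_obj P c)" and "\<And>i g. i < n \<Longrightarrow> g \<in> Hom C (b i) c \<Longrightarrow> z i g = \<zero>"
  shows "z = \<zero>\<^bsub>at_obj P c\<^esub>"
proof
  fix i
  show "z i = \<zero>\<^bsub>at_obj P c\<^esub> i"
  proof (cases "i < n")
    case True
    then have "z i g = \<zero>" for g
      using P_component[OF z True] assms(2)[OF True, of g]
      by (cases "g \<in> Hom C (b i) c") (auto simp: free_module_simps)
    then show ?thesis using True by (auto simp: at_obj_P direct_sum_module_simps free_module_simps)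
  next
    case False
    then show ?thesis
      using z by (auto simp: at_obj_P direct_sum_module_simps PiE_def extensional_def)
  qed
qed

lemma \<phi>_hom: "c \<in> Obj C \<Longrightarrow> \<phi> c \<in> module_hom A (at_obj P c) (at_obj M c)"
  and \<phi>_nat: "\<lbrakk>c \<in> Obj C; d \<in> Obj C; f \<in> Hom C c d; z \<in> carrier (at_obj P c)\<rbrakk>
    \<Longrightarrow> \<phi> d (at_hom P c d f z) = at_hom M c d f (\<phi> c z)"
  and \<phi>_surj: "c \<in> Obj C \<Longrightarrow> \<phi> c ` carrier (at_obj P c) = carrier (at_obj M c)"
  using \<phi> unfolding surjection_def P_def[symmetric] nat_trans_def by blast+

lemma P_push_closed:
  assumes c: "c \<in> Obj C" and d: "d \<in> Obj C" and f: "f \<in> Hom C c d" and z: "z \<in> carrier (at_obj P c)"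
  shows "at_hom P c d f z \<in> carrier (at_obj P d)"
proof -
  have "free_module_map A (Hom C (b i) c) (Hom C (b i) d) (Comp C (b i) c d f) (z i)
      \<in> carrier (free_module A (Hom C (b i) d))" if "i < n" for i
    using Comp_in_Hom[OF b_Obj[OF that] c d _ f]
    by (intro M.free_module_map_closed P_component[OF z that]) auto
  then show ?thesis
    by (simp add: at_hom_P) (simp add: at_obj_P direct_sum_module_simps)
qed

text \<open>An upper bound on the keys instead of an exact leading key: cancellation and the zero
  vector then cause no exceptions, and the vectors below a bound form a submodule.\<close>

definition supported :: "'t \<Rightarrow> 'k \<Rightarrow> (nat \<Rightarrow> 'm \<Rightarrow> 'a) \<Rightarrow> bool" where
  "supported t \<kappa> z \<longleftrightarrow> z \<in> carrier (at_obj P (u t)) \<and>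
    (\<forall>i<n. \<forall>g\<in>Hom C (b i) (u t). z i g \<noteq> \<zero> \<longrightarrow> key t i g \<le> \<kappa>)"

lemma supported_add:
  assumes "supported t \<kappa> z" "supported t \<kappa> w"
  shows "supported t \<kappa> (z \<oplus>\<^bsub>at_obj P (u t)\<^esub> w)"
proof -
  interpret Pt: module A "at_obj P (u t)" by (rule module_P)
  have "key t i g \<le> \<kappa>" if "i < n" "g \<in> Hom C (b i) (u t)" "z i g \<oplus> w i g \<noteq> \<zero>" for i g
    using assms that unfolding supported_def by (metis M.l_zero M.zero_closed)
  then show ?thesis using assms by (simp add: supported_def P_ops)
qed

lemma supported_smult:
  assumes "supported t \<kappa> z" "a \<in> carrier A"
  shows "supported t \<kappa> (a \<odot>\<^bsub>at_obj P (u t)\<^esub> z)"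
proof -
  interpret Pt: module A "at_obj P (u t)" by (rule module_P)
  have "key t i g \<le> \<kappa>" if "i < n" "g \<in> Hom C (b i) (u t)" "a \<otimes> z i g \<noteq> \<zero>" for i g
    using assms that unfolding supported_def by (metis M.r_null)
  then show ?thesis using assms by (simp add: supported_def P_ops)
qed

text \<open>Every basis element in the support of the push comes from one in the support of
  \<open>z\<close>; smaller keys stay smaller, and an equal key means the same basis element.
  Injectivity of composition prevents the coefficient at the leading place from collecting other
  terms.\<close>

lemma supported_push:
  assumes s: "s \<in> T" and t: "t \<in> T" and h: "h \<in> H s t" and j: "j < n" and f: "f \<in> Hom C (b j) (u s)"
    and z: "supported s (key s j f) z"
  defines "hz \<equiv> at_hom P (u s) (u t) h z" and "hf \<equiv> Comp C (b j) (u s) (u t) h f"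
  shows "supported t (key t j hf) hz" and "hz j hf = z j f"
proof -
  have h': "h \<in> Hom C (u s) (u t)" using H_subset[OF s t] h by blast
  have zc: "z \<in> carrier (at_obj P (u s))" using z by (simp add: supported_def)
  have p: "Comp C (b i) (u s) (u t) h \<in> Hom C (b i) (u s) \<rightarrow> Hom C (b i) (u t)" if "i < n" for i
    using Comp_in_Hom[OF b_Obj[OF that] u_Obj[OF s] u_Obj[OF t] _ h'] by blast
  show "hz j hf = z j f"
    unfolding hz_def hf_def at_hom_P using j
    by (simp add: M.free_module_map_apply_inj[OF Comp_inj_on[OF s t h j] p[OF j] f P_component[OF zc j]])
  have "key t i g \<le> key t j hf" if i: "i < n" and nz: "hz i g \<noteq> \<zero>" for i g
  proof -
    have "free_module_map A (Hom C (b i) (u s)) (Hom C (b i) (u t)) (Comp C (b i) (u s) (u t) h) (z i) g \<noteq> \<zero>"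
      using nz i by (simp add: hz_def at_hom_P)
    then obtain f' where f': "f' \<in> Hom C (b i) (u s)" "z i f' \<noteq> \<zero>" "Comp C (b i) (u s) (u t) h f' = g"
      by (rule M.free_module_map_support)
    then have "key s i f' \<le> key s j f" using z i by (simp add: supported_def)
    then consider "key s i f' < key s j f" | "key s i f' = key s j f" by fastforce
    then show ?thesis
    proof cases
      case 1
      then show ?thesis using key_mono[OF s t h i j f'(1) f] f'(3) by (simp add: hf_def)
    next
      case 2
      then show ?thesis using key_inj[OF s i j f'(1) f] f'(3) by (simp add: hf_def)
    qed
  qed
  then show "supported t (key t j hf) hz"
    using P_push_closed[OF u_Obj[OF s] u_Obj[OF t] h' zc] by (simp add: supported_def hz_def)
qed

text \<open>Hom-sets are finite, so the keys in the support form a finite set, nonempty because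
  \<open>z\<close> is not zero. Its maximum is the new bound.\<close>

lemma supported_lower:
  assumes t: "t \<in> T" and z: "supported t \<kappa> z" and nz: "z \<noteq> \<zero>\<^bsub>at_obj P (u t)\<^esub>"
    and lead: "\<And>i g. i < n \<Longrightarrow> g \<in> Hom C (b i) (u t) \<Longrightarrow> key t i g = \<kappa> \<Longrightarrow> z i g = \<zero>"
  shows "\<exists>\<kappa>'<\<kappa>. supported t \<kappa>' z"
proof -
  define K where "K = (\<lambda>(i, g). key t i g) ` {(i, g) \<in> Sigma {..<n} (\<lambda>i. Hom C (b i) (u t)). z i g \<noteq> \<zero>}"
  have zc: "z \<in> carrier (at_obj P (u t))" using z by (simp add: supported_def)
  have "finite (Sigma {..<n} (\<lambda>i. Hom C (b i) (u t)))"
    using finite_Hom b_Obj u_Obj[OF t] by (intro finite_SigmaI) auto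
  then have K: "finite K"
    unfolding K_def by (intro finite_imageI) (rule finite_subset[rotated], auto)
  have memK: "key t i g \<in> K" if "i < n" "g \<in> Hom C (b i) (u t)" "z i g \<noteq> \<zero>" for i g
    using that by (auto simp: K_def)
  have "K \<noteq> {}"
  proof
    assume "K = {}"
    then have "z i g = \<zero>" if "i < n" "g \<in> Hom C (b i) (u t)" for i g using memK that by blast
    then show False using P_zeroI[OF zc] nz by blast
  qed
  then have "Max K \<in> K" using K by simp
  then have "Max K < \<kappa>"
    using z lead by (auto simp: K_def supported_def order_less_le)
  moreover have "supported t (Max K) z"
    using zc memK K by (simp add: supported_def)
  ultimately show ?thesis by blast
qed

text \<open>The vectors \<open>y\<close> range over the preimage in \<open>P\<close> of the
  generated submodule, kernel of \<open>\<phi>\<close> included, so that leading terms can be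
  subtracted in \<open>P\<close> while membership is judged in \<open>M\<close>. As
  \<open>supported\<close> only gives a bound, the coefficient may be zero, as an ideal
  requires.\<close>

definition lead_ideal :: "('o \<times> 'x) set \<Rightarrow> 't \<Rightarrow> nat \<Rightarrow> 'm \<Rightarrow> 'a set" where
  "lead_ideal E t i g =
    {y i g | y. supported t (key t i g) y \<and> \<phi> (u t) y \<in> generated_sub C A M E (u t)}"

lemma ideal_lead_ideal:
  assumes t: "t \<in> T" and i: "i < n"
  shows "ideal (lead_ideal E t i g) A"
proof -
  interpret Pt: module A "at_obj P (u t)" by (rule module_P)
  interpret Mt: module A "at_obj M (u t)" by (rule M.module_at_obj[OF u_Obj[OF t]])
  note gen = M.sub_cmodD[OF M.sub_cmod_generated_sub[where E = E] u_Obj[OF t]]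
  note hom = \<phi>_hom[OF u_Obj[OF t]]
  have carr: "y \<in> carrier (at_obj P (u t))" if "supported t \<kappa> y" for \<kappa> y
    using that by (simp add: supported_def)
  have sub: "lead_ideal E t i g \<subseteq> carrier A"
    using P_coeff[OF carr i] by (auto simp: lead_ideal_def)
  have smult: "a \<otimes> x \<in> lead_ideal E t i g" if a: "a \<in> carrier A" and x: "x \<in> lead_ideal E t i g" for a x
  proof -
    obtain y where y: "supported t (key t i g) y" "\<phi> (u t) y \<in> generated_sub C A M E (u t)" "x = y i g"
      using x by (auto simp: lead_ideal_def)
    have "\<phi> (u t) (a \<odot>\<^bsub>at_obj P (u t)\<^esub> y) \<in> generated_sub C A M E (u t)"
      using gen(5)[OF a y(2)] by (simp add: module_hom_smult[OF hom a carr[OF y(1)]])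
    then show ?thesis
      using supported_smult[OF y(1) a] y(3)
      unfolding lead_ideal_def
      by (intro CollectI exI[of _ "a \<odot>\<^bsub>at_obj P (u t)\<^esub> y"]) (simp add: P_ops[OF i])
  qed
  have add: "x \<oplus> x' \<in> lead_ideal E t i g" if x: "x \<in> lead_ideal E t i g" and x': "x' \<in> lead_ideal E t i g" for x x'
  proof -
    obtain y where y: "supported t (key t i g) y" "\<phi> (u t) y \<in> generated_sub C A M E (u t)" "x = y i g"
      using x by (auto simp: lead_ideal_def)
    obtain y' where y': "supported t (key t i g) y'" "\<phi> (u t) y' \<in> generated_sub C A M E (u t)" "x' = y' i g"
      using x' by (auto simp: lead_ideal_def)
    have "\<phi> (u t) (y \<oplus>\<^bsub>at_obj P (u t)\<^esub> y') \<in> generated_sub C A M E (u t)"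
      using gen(3)[OF y(2) y'(2)] by (simp add: module_hom_add[OF hom carr[OF y(1)] carr[OF y'(1)]])
    then show ?thesis
      using supported_add[OF y(1) y'(1)] y(3) y'(3)
      unfolding lead_ideal_def
      by (intro CollectI exI[of _ "y \<oplus>\<^bsub>at_obj P (u t)\<^esub> y'"]) (simp add: P_ops[OF i])
  qed
  have "supported t (key t i g) \<zero>\<^bsub>at_obj P (u t)\<^esub>"
    unfolding supported_def using Pt.M.zero_closed by (simp add: at_obj_P direct_sum_module_simps free_module_simps)
  moreover have "\<phi> (u t) \<zero>\<^bsub>at_obj P (u t)\<^esub> \<in> generated_sub C A M E (u t)"
    using gen(2) by (simp add: module_hom_zero[OF module_P M.module_at_obj[OF u_Obj[OF t]] hom])
  ultimately have ne: "lead_ideal E t i g \<noteq> {}"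
    unfolding lead_ideal_def by blast
  have "\<ominus> x \<in> lead_ideal E t i g" if "x \<in> lead_ideal E t i g" for x
  proof -
    have "\<ominus> x = (\<ominus> \<one>) \<otimes> x" using that sub by (auto simp: M.l_minus)
    then show ?thesis using smult[OF _ that, of "\<ominus> \<one>"] by simp
  qed
  then have "subgroup (lead_ideal E t i g) (add_monoid A)"
    using sub ne add by (intro M.add.subgroupI)
  then show ?thesis
  proof (rule idealI[OF M.ring_axioms])
    show "a \<otimes> x \<in> lead_ideal E t i g" if "x \<in> lead_ideal E t i g" "a \<in> carrier A" for x a
      using smult that by blast
    then show "x \<otimes> a \<in> lead_ideal E t i g" if "x \<in> lead_ideal E t i g" "a \<in> carrier A" for x a
      using that sub M.m_comm by (metis subsetD)
  qed
qed

text \<open>Submodules are stable under every morphism and the push keeps leading coefficients, so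
  divisibility of basis elements becomes inclusion of ideals. \<open>E\<close> may grow at the same
  time because the dividend is reached at a later stage.\<close>

lemma lead_ideal_push:
  assumes s: "s \<in> T" and t: "t \<in> T" and h: "h \<in> H s t" and i: "i < n" and f: "f \<in> Hom C (b i) (u s)"
    and E: "E \<subseteq> E'"
  shows "lead_ideal E s i f \<subseteq> lead_ideal E' t i (Comp C (b i) (u s) (u t) h f)"
proof
  fix x assume "x \<in> lead_ideal E s i f"
  then obtain y where y: "supported s (key s i f) y" "\<phi> (u s) y \<in> generated_sub C A M E (u s)" "x = y i f"
    by (auto simp: lead_ideal_def)
  have h': "h \<in> Hom C (u s) (u t)" using H_subset[OF s t] h by blast
  have "y \<in> carrier (at_obj P (u s))" using y(1) by (simp add: supported_def)
  then have "\<phi> (u t) (at_hom P (u s) (u t) h y) = at_hom M (u s) (u t) h (\<phi> (u s) y)"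
    by (rule \<phi>_nat[OF u_Obj[OF s] u_Obj[OF t] h'])
  moreover have "\<phi> (u s) y \<in> generated_sub C A M E' (u s)"
    using y(2) generated_sub_mono[OF E] by blast
  ultimately have "\<phi> (u t) (at_hom P (u s) (u t) h y) \<in> generated_sub C A M E' (u t)"
    using M.sub_cmodD(6)[OF M.sub_cmod_generated_sub u_Obj[OF s] u_Obj[OF t] h'] by simp
  then show "x \<in> lead_ideal E' t i (Comp C (b i) (u s) (u t) h f)"
    using supported_push[OF s t h i f y(1)] y(3) unfolding lead_ideal_def
    by (intro CollectI exI[of _ "at_hom P (u s) (u t) h y"]) simp
qed

definition witness :: "('o \<times> 'x) set \<Rightarrow> 'k \<Rightarrow> 't \<Rightarrow> (nat \<Rightarrow> 'm \<Rightarrow> 'a) \<Rightarrow> bool" where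
  "witness E \<kappa> t z \<longleftrightarrow> t \<in> T \<and> supported t \<kappa> z \<and> \<phi> (u t) z \<in> N (u t) - generated_sub C A M E (u t)"

text \<open>Suppose some \<open>y\<close> with image in the generated submodule had the leading
  coefficient of \<open>z\<close>. Then \<open>z\<close> minus \<open>y\<close> would still be a
  witness, since the image changes by an element of that submodule, but it would vanish at the
  leading place and hence obey a smaller bound.\<close>

lemma minimal_witness_lead:
  assumes w: "witness E \<kappa> t z" and min: "\<And>\<kappa>' t' z'. witness E \<kappa>' t' z' \<Longrightarrow> \<kappa> \<le> \<kappa>'"
    and E: "\<And>c x. (c, x) \<in> E \<Longrightarrow> x \<in> N c"
  shows "\<exists>i<n. \<exists>g\<in>Hom C (b i) (u t). key t i g = \<kappa> \<and> z i g \<notin> lead_ideal E t i g"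
proof -
  have t: "t \<in> T" and z: "supported t \<kappa> z"
    and \<phi>z: "\<phi> (u t) z \<in> N (u t)" "\<phi> (u t) z \<notin> generated_sub C A M E (u t)"
    using w by (auto simp: witness_def)
  note ut = u_Obj[OF t]
  note gen = M.sub_cmodD[OF M.sub_cmod_generated_sub[where E = E] ut]
  note hom = \<phi>_hom[OF ut]
  interpret Pt: module A "at_obj P (u t)" by (rule module_P)
  interpret Mt: module A "at_obj M (u t)" by (rule M.module_at_obj[OF ut])
  have zc: "z \<in> carrier (at_obj P (u t))" using z by (simp add: supported_def)
  \<comment> \<open>A witness at the minimal bound attains it: it is not zero, as zero maps into the
    generated submodule, so otherwise \<open>supported_lower\<close> would give a smaller
    bound.\<close>
  have lead: "\<exists>i<n. \<exists>g\<in>Hom C (b i) (u t). key t i g = \<kappa> \<and> z' i g \<noteq> \<zero>" if w': "witness E \<kappa> t z'" for z'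
  proof (rule ccontr)
    assume no: "\<not> ?thesis"
    have "z' \<noteq> \<zero>\<^bsub>at_obj P (u t)\<^esub>"
      using w' gen(2) module_hom_zero[OF module_P M.module_at_obj[OF ut] hom] by (auto simp: witness_def)
    then obtain \<kappa>' where "\<kappa>' < \<kappa>" "supported t \<kappa>' z'"
      using supported_lower[OF t, of \<kappa> z'] w' no by (auto simp: witness_def)
    then have "witness E \<kappa>' t z'" using w' by (simp add: witness_def)
    then show False using min \<open>\<kappa>' < \<kappa>\<close> by fastforce
  qed
  obtain i g where i: "i < n" and g: "g \<in> Hom C (b i) (u t)" and key: "key t i g = \<kappa>"
    using lead[OF w] by blast
  have "z i g \<notin> lead_ideal E t i g"
  proof
    assume "z i g \<in> lead_ideal E t i g"
    then obtain y where y: "supported t \<kappa> y" "\<phi> (u t) y \<in> generated_sub C A M E (u t)" "z i g = y i g"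
      by (auto simp: lead_ideal_def key)
    have yc: "y \<in> carrier (at_obj P (u t))" using y(1) by (simp add: supported_def)
    define v where "v = (\<ominus> \<one>) \<odot>\<^bsub>at_obj P (u t)\<^esub> y"
    have vc: "v \<in> carrier (at_obj P (u t))" using yc by (simp add: v_def)
    have \<phi>v: "\<phi> (u t) v = (\<ominus> \<one>) \<odot>\<^bsub>at_obj M (u t)\<^esub> \<phi> (u t) y"
      unfolding v_def by (rule module_hom_smult[OF hom _ yc]) simp
    then have gv: "\<phi> (u t) v \<in> generated_sub C A M E (u t)"
      using gen(5)[OF _ y(2)] by simp
    let ?z' = "z \<oplus>\<^bsub>at_obj P (u t)\<^esub> v"
    have \<phi>z': "\<phi> (u t) ?z' = \<phi> (u t) z \<oplus>\<^bsub>at_obj M (u t)\<^esub> \<phi> (u t) v"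
      by (rule module_hom_add[OF hom zc vc])
    have "generated_sub C A M E (u t) \<subseteq> N (u t)"
      by (rule generated_sub_subset[OF N E])
    then have inN: "\<phi> (u t) ?z' \<in> N (u t)"
      using M.sub_cmodD(3)[OF N ut \<phi>z(1)] gv \<phi>z' by auto
    have "\<phi> (u t) ?z' \<notin> generated_sub C A M E (u t)"
    proof
      assume "\<phi> (u t) ?z' \<in> generated_sub C A M E (u t)"
      then have "\<phi> (u t) ?z' \<oplus>\<^bsub>at_obj M (u t)\<^esub> (\<ominus>\<^bsub>at_obj M (u t)\<^esub> \<phi> (u t) v) \<in> generated_sub C A M E (u t)"
        using gen(3) gen(4)[OF gv] by blast
      then show False
        using \<phi>z(2) module_hom_closed[OF hom zc] module_hom_closed[OF hom vc]
        by (simp add: \<phi>z' Mt.M.a_assoc Mt.M.r_neg)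
    qed
    then have "witness E \<kappa> t ?z'"
      using t inN supported_add[OF z] supported_smult[OF y(1)] by (simp add: witness_def v_def)
    \<comment> \<open>\<open>lead\<close> finds a nonzero coefficient of the difference at key
      \<open>\<kappa>\<close>. By injectivity of keys this is the place \<open>(i, g)\<close>, where
      the coefficients of \<open>z\<close> and \<open>y\<close> cancel.\<close>
    then obtain j g' where j: "j < n" "g' \<in> Hom C (b j) (u t)" "key t j g' = \<kappa>" "?z' j g' \<noteq> \<zero>"
      using lead by blast
    then have "j = i" "g' = g" using key_inj[OF t j(1) i j(2) g] key by simp_all
    moreover have "?z' i g = \<zero>"
      using P_coeff[OF yc i] y(3) i by (simp add: P_ops v_def M.l_minus M.r_neg)
    ultimately show False using j(4) by simp
  qed
  then show ?thesis using i g key by blast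
qed


lemma ex_minimal_witness:
  assumes "t \<in> T" "x \<in> N (u t)" "x \<notin> generated_sub C A M E (u t)"
  shows "\<exists>\<kappa> t z. witness E \<kappa> t z \<and> (\<forall>\<kappa>' t' z'. witness E \<kappa>' t' z' \<longrightarrow> \<kappa> \<le> \<kappa>')"
proof -
  note ut = u_Obj[OF assms(1)]
  have "x \<in> carrier (at_obj M (u t))" using assms(2) M.sub_cmodD(1)[OF N ut] by blast
  then obtain z where z: "z \<in> carrier (at_obj P (u t))" "x = \<phi> (u t) z"
    unfolding \<phi>_surj[OF ut, symmetric] by (rule imageE) simp
  define K where "K = (\<lambda>(i, g). key t i g) ` Sigma {..<n} (\<lambda>i. Hom C (b i) (u t))"
  have K: "finite K"
    unfolding K_def using finite_Hom b_Obj ut by (intro finite_imageI finite_SigmaI) auto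
  \<comment> \<open>Any common bound will do for existence; the inserted \<open>undefined\<close>
    keeps \<open>Max\<close> meaningful when there are no basis elements over
    \<open>u t\<close>.\<close>
  have "key t i g \<le> Max (insert undefined K)" if "i < n" "g \<in> Hom C (b i) (u t)" for i g
    using that K by (intro Max_ge) (auto simp: K_def)
  then have ex: "\<exists>\<kappa> t z. witness E \<kappa> t z"
    using assms z unfolding witness_def supported_def by blast
  define \<kappa> where "\<kappa> = (LEAST \<kappa>. \<exists>t z. witness E \<kappa> t z)"
  have "\<exists>t z. witness E \<kappa> t z"
    unfolding \<kappa>_def using ex by (rule LeastI_ex)
  moreover have "\<kappa> \<le> \<kappa>'" if "witness E \<kappa>' t' z'" for \<kappa>' t' z'
    unfolding \<kappa>_def using that by (intro Least_le) blast
  ultimately show ?thesis by blast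
qed

theorem finitely_generated_restrict: "finitely_generated C A (restrict_cmod M N)"
proof (rule ccontr)
  assume not_fg: "\<not> ?thesis"
  define good where "good E \<longleftrightarrow> finite E \<and> (\<forall>(c, x)\<in>E. c \<in> Obj C \<and> x \<in> N c)" for E
  have "\<exists>\<kappa> t z. witness E \<kappa> t z \<and> (\<forall>\<kappa>' t' z'. witness E \<kappa>' t' z' \<longrightarrow> \<kappa> \<le> \<kappa>')" if E: "good E" for E
  proof -
    have "\<exists>c\<in>Obj C. \<not> N c \<subseteq> generated_sub C A M E c"
    proof (rule ccontr)
      assume all: "\<not> ?thesis"
      have "finitely_generated C A (restrict_cmod M N)"
      proof (rule M.finitely_generated_restrictI[OF finite_Hom N])
        show "c \<in> Obj C \<and> x \<in> N c" if "(c, x) \<in> E" for c x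
          using E that by (auto simp: good_def)
        show "finite E" using E by (simp add: good_def)
        fix S c assume S: "sub_cmod C A M S" "\<And>c x. (c, x) \<in> E \<Longrightarrow> x \<in> S c" and c: "c \<in> Obj C"
        have "N c \<subseteq> generated_sub C A M E c" using all c by blast
        also have "\<dots> \<subseteq> S c" by (rule generated_sub_subset[OF S])
        finally show "N c \<subseteq> S c" .
      qed
      then show False using not_fg by blast
    qed
    then obtain c x where c: "c \<in> Obj C" and x: "x \<in> N c" "x \<notin> generated_sub C A M E c" by blast
    obtain t where "t \<in> T" "c = u t" using c unfolding u_image[symmetric] by (rule imageE) simp
    then show ?thesis using ex_minimal_witness[of t x E] x by simp
  qed
  \<comment> \<open>The choice is made for all \<open>E\<close> at once, guarded by
    \<open>good E\<close>, so that the generators can be defined by plain recursion before goodness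
    is proved by induction.\<close>
  then have "\<forall>E. \<exists>\<kappa> t z. good E \<longrightarrow>
      witness E \<kappa> t z \<and> (\<forall>\<kappa>' t' z'. witness E \<kappa>' t' z' \<longrightarrow> \<kappa> \<le> \<kappa>')"
    by blast
  then have "\<exists>\<kappa> t z. \<forall>E. good E \<longrightarrow>
      witness E (\<kappa> E) (t E) (z E) \<and> (\<forall>\<kappa>' t' z'. witness E \<kappa>' t' z' \<longrightarrow> \<kappa> E \<le> \<kappa>')"
    by (simp only: choice_iff)
  then obtain \<kappa> t z where \<kappa>tz: "\<forall>E. good E \<longrightarrow>
      witness E (\<kappa> E) (t E) (z E) \<and> (\<forall>\<kappa>' t' z'. witness E \<kappa>' t' z' \<longrightarrow> \<kappa> E \<le> \<kappa>')"
    by (elim exE) (rule that)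
  have step: "witness E (\<kappa> E) (t E) (z E)" if "good E" for E
    using \<kappa>tz that by blast
  have min: "\<kappa> E \<le> \<kappa>'" if "good E" "witness E \<kappa>' t' z'" for E \<kappa>' t' z'
    using \<kappa>tz that by blast
  define E where "E = rec_nat {} (\<lambda>_ E. insert (u (t E), \<phi> (u (t E)) (z E)) E)"
  have E_Suc: "E (Suc k) = insert (u (t (E k)), \<phi> (u (t (E k))) (z (E k))) (E k)" for k
    by (simp add: E_def)
  have good: "good (E k)" for k
  proof (induction k)
    case 0
    then show ?case by (simp add: E_def good_def)
  next
    case (Suc k)
    then show ?case using step[OF Suc] u_Obj by (auto simp: E_Suc good_def witness_def)
  qed
  have E_mono: "E j \<subseteq> E k" if "j \<le> k" for j k
    using that by (rule lift_Suc_mono_le[rotated]) (auto simp: E_Suc)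
  define \<tau> \<zeta> where "\<tau> k = t (E k)" and "\<zeta> k = z (E k)" for k
  have w: "witness (E k) (\<kappa> (E k)) (\<tau> k) (\<zeta> k)" for k
    unfolding \<tau>_def \<zeta>_def by (rule step[OF good])
  have \<tau>: "\<tau> k \<in> T" for k using w by (simp add: witness_def)
  have EN: "x \<in> N c" if "(c, x) \<in> E k" for c x k
    using good[of k] that by (auto simp: good_def)
  have "\<exists>i<n. \<exists>g\<in>Hom C (b i) (u (\<tau> k)). key (\<tau> k) i g = \<kappa> (E k) \<and> \<zeta> k i g \<notin> lead_ideal (E k) (\<tau> k) i g" for k
    by (rule minimal_witness_lead[OF w min[OF good] EN])
  then obtain i g where i: "\<And>k. i k < n" and g: "\<And>k. g k \<in> Hom C (b (i k)) (u (\<tau> k))"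
    and key: "\<And>k. key (\<tau> k) (i k) (g k) = \<kappa> (E k)"
    and new: "\<And>k. \<zeta> k (i k) (g k) \<notin> lead_ideal (E k) (\<tau> k) (i k) (g k)"
    by metis
  \<comment> \<open>The chosen vector is its own certificate: its image becomes a generator, so its
    leading coefficient enters the ideal one stage later.\<close>
  have in_suc: "\<zeta> k (i k) (g k) \<in> lead_ideal (E (Suc k)) (\<tau> k) (i k) (g k)" for k
  proof -
    have z: "supported (\<tau> k) (\<kappa> (E k)) (\<zeta> k)" using w by (simp add: witness_def)
    then have "\<phi> (u (\<tau> k)) (\<zeta> k) \<in> carrier (at_obj M (u (\<tau> k)))"
      by (intro module_hom_closed[OF \<phi>_hom[OF u_Obj[OF \<tau>]]]) (simp add: supported_def)
    then have "\<phi> (u (\<tau> k)) (\<zeta> k) \<in> generated_sub C A M (E (Suc k)) (u (\<tau> k))"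
      by (intro generated_sub_base) (simp_all add: E_Suc \<tau>_def \<zeta>_def)
    with z show ?thesis unfolding lead_ideal_def key by blast
  qed
  have "\<exists>r::nat \<Rightarrow> nat. strict_mono r \<and> (\<forall>p q. p < q \<longrightarrow>
      (\<exists>h\<in>H (\<tau> (r p)) (\<tau> (r q)). i (r p) = i (r q) \<and>
        Comp C (b (i (r p))) (u (\<tau> (r p))) (u (\<tau> (r q))) h (g (r p)) = g (r q)))"
    using wqo_on_homogeneous_subseq[OF wqo, of "\<lambda>k. (\<tau> k, i k, g k)"] \<tau> i g by simp
  then obtain r :: "nat \<Rightarrow> nat" where r: "strict_mono r"
    and div: "\<forall>p q. p < q \<longrightarrow> (\<exists>h\<in>H (\<tau> (r p)) (\<tau> (r q)). i (r p) = i (r q) \<and>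
        Comp C (b (i (r p))) (u (\<tau> (r p))) (u (\<tau> (r q))) h (g (r p)) = g (r q))"
    by (elim exE conjE) (rule that)
  \<comment> \<open>Stage \<open>r p\<close> precedes the addition of the generator with index
    \<open>r p\<close>, so by \<open>new\<close> its coefficient is missing from \<open>I p\<close>;
    it is present one stage later, and \<open>push\<close> puts it into
    \<open>I (Suc p)\<close>.\<close>
  define I where "I p = lead_ideal (E (r p)) (\<tau> (r p)) (i (r p)) (g (r p))" for p
  have push: "lead_ideal (E (Suc (r p))) (\<tau> (r p)) (i (r p)) (g (r p)) \<subseteq> I (Suc p)" for p
  proof -
    obtain h where h: "h \<in> H (\<tau> (r p)) (\<tau> (r (Suc p)))" "i (r p) = i (r (Suc p))"
      "Comp C (b (i (r p))) (u (\<tau> (r p))) (u (\<tau> (r (Suc p)))) h (g (r p)) = g (r (Suc p))"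
      using div lessI[of p] by blast
    \<comment> \<open>Since \<open>r\<close> is strictly increasing, \<open>Suc (r p)\<close> is at
      most \<open>r (Suc p)\<close>, so the generator just added is still present.\<close>
    have "E (Suc (r p)) \<subseteq> E (r (Suc p))"
      using strict_monoD[OF r, of p "Suc p"] by (intro E_mono) simp
    from lead_ideal_push[OF \<tau> \<tau> h(1) i g this] show ?thesis
      by (simp add: I_def h(2)[symmetric] h(3))
  qed
  have "\<exists>p. I (Suc p) \<subseteq> I p"
  proof (rule noetherian_ring.ideal_sequence_stabilizes[OF noeth])
    show "ideal (I p) A" for p
      unfolding I_def by (rule ideal_lead_ideal[OF \<tau> i])
    have "lead_ideal (E k) (\<tau> k) (i k) (g k) \<subseteq> lead_ideal (E (Suc k)) (\<tau> k) (i k) (g k)" for k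
      using generated_sub_mono[OF E_mono[of k "Suc k"]] by (fastforce simp: lead_ideal_def)
    then show "I p \<subseteq> I (Suc p)" for p
      using push[of p] by (fastforce simp: I_def)
  qed
  then obtain p where "I (Suc p) \<subseteq> I p" by blast
  then have "\<zeta> (r p) (i (r p)) (g (r p)) \<in> I p"
    using in_suc[of "r p"] push[of p] by blast
  then show False using new[of "r p"] by (simp add: I_def)
qed

end

end

section \<open>Ordered cographs\<close>

fun leaves :: "'a cotree \<Rightarrow> 'a list" where
  "leaves (Leaf a) = [a]"
| "leaves (Node b l r) = leaves l @ leaves r"

lemma leaves_nonempty: "leaves t \<noteq> []"
  by (induction t) auto

fun cotree_graph :: "'v cotree \<Rightarrow> 'v sgraph" where
  "cotree_graph (Leaf v) = \<lparr>verts = {v}, edges = {}\<rparr>"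
| "cotree_graph (Node b l r) = \<lparr>verts = verts (cotree_graph l) \<union> verts (cotree_graph r),
     edges = edges (cotree_graph l) \<union> edges (cotree_graph r) \<union>
       (if b then {{x, y} | x y. x \<in> verts (cotree_graph l) \<and> y \<in> verts (cotree_graph r)} else {})\<rparr>"

lemma verts_cotree_graph [simp]: "verts (cotree_graph t) = set (leaves t)"
  by (induction t) auto

lemma edges_cotree_graph_subset: "e \<in> edges (cotree_graph t) \<Longrightarrow> e \<subseteq> set (leaves t)"
  by (induction t) (auto split: if_splits)

lemma edge_cotree_graph_leaf:
  assumes "{x, y} \<in> edges (cotree_graph t)"
  shows "x \<in> set (leaves t)" "y \<in> set (leaves t)"
  using edges_cotree_graph_subset[OF assms] by auto

lemma edges_cotree_graph_card:
  "distinct (leaves t) \<Longrightarrow> e \<in> edges (cotree_graph t) \<Longrightarrow> card e = 2"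
  by (induction t) (auto split: if_splits simp: card_insert_if)

lemma edge_cotree_graph_Node:
  "{x, y} \<in> edges (cotree_graph (Node b l r)) \<longleftrightarrow>
    {x, y} \<in> edges (cotree_graph l) \<or> {x, y} \<in> edges (cotree_graph r) \<or>
    b \<and> (x \<in> set (leaves l) \<and> y \<in> set (leaves r) \<or> x \<in> set (leaves r) \<and> y \<in> set (leaves l))"
  by (auto simp: doubleton_eq_iff)

fun cotree_complement :: "'v cotree \<Rightarrow> 'v cotree" where
  "cotree_complement (Leaf v) = Leaf v"
| "cotree_complement (Node b l r) = Node (\<not> b) (cotree_complement l) (cotree_complement r)"

lemma leaves_cotree_complement [simp]: "leaves (cotree_complement t) = leaves t"
  by (induction t) auto

text \<open>Adjacency of two distinct leaves is decided at their lowest common ancestor, whose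
  Boolean is flipped.\<close>

lemma edge_cotree_complement:
  assumes "distinct (leaves t)" "x \<in> set (leaves t)" "y \<in> set (leaves t)" "x \<noteq> y"
  shows "{x, y} \<in> edges (cotree_graph (cotree_complement t)) \<longleftrightarrow> {x, y} \<notin> edges (cotree_graph t)"
  using assms
proof (induction t)
  case (Leaf v)
  then show ?case by simp
next
  case (Node b l r)
  have dist: "distinct (leaves l)" "distinct (leaves r)" "set (leaves l) \<inter> set (leaves r) = {}"
    using Node.prems(1) by auto
  have no: "{x, y} \<notin> edges (cotree_graph t)"
    if "x \<notin> set (leaves t) \<or> y \<notin> set (leaves t)" for t
    using edge_cotree_graph_leaf[of x y t] that by blast
  consider "x \<in> set (leaves l)" "y \<in> set (leaves l)" | "x \<in> set (leaves r)" "y \<in> set (leaves r)"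
    | "x \<in> set (leaves l)" "y \<in> set (leaves r)" | "x \<in> set (leaves r)" "y \<in> set (leaves l)"
    using Node.prems(2,3) by auto
  then show ?case
  proof cases
    case 1
    then have nr: "x \<notin> set (leaves r)" "y \<notin> set (leaves r)" using dist(3) by auto
    then show ?thesis
      using Node.IH(1)[OF dist(1) 1 Node.prems(4)] no[of r] no[of "cotree_complement r"]
      unfolding cotree_complement.simps edge_cotree_graph_Node by simp
  next
    case 2
    then have nl: "x \<notin> set (leaves l)" "y \<notin> set (leaves l)" using dist(3) by auto
    then show ?thesis
      using Node.IH(2)[OF dist(2) 2 Node.prems(4)] no[of l] no[of "cotree_complement l"]
      unfolding cotree_complement.simps edge_cotree_graph_Node by simp
  next
    case 3
    then have "y \<notin> set (leaves l)" "x \<notin> set (leaves r)" using dist(3) by auto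
    then show ?thesis
      using 3 no[of l] no[of "cotree_complement l"] no[of r] no[of "cotree_complement r"]
      unfolding cotree_complement.simps edge_cotree_graph_Node by simp
  next
    case 4
    then have "x \<notin> set (leaves l)" "y \<notin> set (leaves r)" using dist(3) by auto
    then show ?thesis
      using 4 no[of l] no[of "cotree_complement l"] no[of r] no[of "cotree_complement r"]
      unfolding cotree_complement.simps edge_cotree_graph_Node by simp
  qed
qed

lemma cotree_graph_complement:
  assumes t: "distinct (leaves t)"
  shows "cotree_graph (cotree_complement t) = complement (cotree_graph t)"
proof -
  have "edges (cotree_graph (cotree_complement t))
      = {e. e \<subseteq> set (leaves t) \<and> card e = 2} - edges (cotree_graph t)" (is "?L = ?R")
  proof (rule Set.set_eqI, rule iffI)
    fix e assume e: "e \<in> ?L"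
    then have "e \<subseteq> set (leaves t)" "card e = 2"
      using edges_cotree_graph_subset[OF e] edges_cotree_graph_card[OF _ e] t by simp_all
    then show "e \<in> ?R"
      using edge_cotree_complement[OF t] e by (auto simp: card_2_iff)
  next
    fix e assume "e \<in> ?R"
    then show "e \<in> ?L"
      using edge_cotree_complement[OF t] by (auto simp: card_2_iff)
  qed
  then show ?thesis
    by (intro sgraph.equality) (simp_all add: complement_def)
qed

text \<open>A disjoint union is a root with Boolean \<open>False\<close>; a complement flips every
  Boolean and keeps the leaves. Distinctness of the leaves is carried along because it makes the two
  sides of every node disjoint.\<close>

lemma cograph_cotree: "cograph G \<Longrightarrow> \<exists>t. distinct (leaves t) \<and> cotree_graph t = G"
proof (induction rule: cograph.induct)
  case (isolated_vertex v)
  then show ?case by (intro exI[of _ "Leaf v"]) simp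
next
  case (disjoint_union G H)
  then obtain s t where "distinct (leaves s)" "cotree_graph s = G" "distinct (leaves t)" "cotree_graph t = H"
    by blast
  with disjoint_union.hyps(3) show ?case
    by (intro exI[of _ "Node False s t"]) auto
next
  case (complement G)
  then obtain t where "distinct (leaves t)" "cotree_graph t = G" by blast
  then show ?case
    by (intro exI[of _ "cotree_complement t"]) (simp add: cotree_graph_complement)
qed

text \<open>An element that does not occur in the list has its length as position.\<close>

definition pos :: "'a list \<Rightarrow> 'a \<Rightarrow> nat" where
  "pos xs v = length (takeWhile (\<lambda>w. w \<noteq> v) xs)"

section \<open>Positions of leaves and order-preserving full embeddings\<close>

lemma nth_pos:
  assumes "v \<in> set xs"
  shows "pos xs v < length xs" "xs ! pos xs v = v"
proof -
  show "pos xs v < length xs"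
    using assms by (induction xs) (auto simp: pos_def)
  then show "xs ! pos xs v = v"
    unfolding pos_def using nth_length_takeWhile by fastforce
qed

lemma pos_inj: "x \<in> set xs \<Longrightarrow> y \<in> set xs \<Longrightarrow> pos xs x = pos xs y \<Longrightarrow> x = y"
  by (metis nth_pos(2))

lemma pos_append: "pos (xs @ ys) v = (if v \<in> set xs then pos xs v else length xs + pos ys v)"
  by (auto simp: pos_def takeWhile_append)

text \<open>Maps are unconstrained off the leaves of \<open>s\<close>, so that embeddings of two
  subtrees can be glued by a case distinction; they are restricted only when a morphism is needed.
  Injectivity follows from strict monotonicity of positions.\<close>

definition ordered_embedding :: "'a cotree \<Rightarrow> 'a cotree \<Rightarrow> ('a \<Rightarrow> 'a) \<Rightarrow> bool" where
  "ordered_embedding s t h \<longleftrightarrow> h ` set (leaves s) \<subseteq> set (leaves t) \<and>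
    (\<forall>x\<in>set (leaves s). \<forall>y\<in>set (leaves s).
      (pos (leaves s) x < pos (leaves s) y \<longrightarrow> pos (leaves t) (h x) < pos (leaves t) (h y)) \<and>
      ({h x, h y} \<in> edges (cotree_graph t) \<longleftrightarrow> {x, y} \<in> edges (cotree_graph s)))"

lemma ordered_embeddingD:
  assumes "ordered_embedding s t h" "x \<in> set (leaves s)" "y \<in> set (leaves s)"
  shows "h x \<in> set (leaves t)"
    and "pos (leaves s) x < pos (leaves s) y \<Longrightarrow> pos (leaves t) (h x) < pos (leaves t) (h y)"
    and "{h x, h y} \<in> edges (cotree_graph t) \<longleftrightarrow> {x, y} \<in> edges (cotree_graph s)"
  using assms by (auto simp: ordered_embedding_def)

lemma ordered_embedding_inj:
  assumes h: "ordered_embedding s t h"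
  shows "inj_on h (set (leaves s))"
proof (rule inj_onI, rule ccontr)
  fix x y assume x: "x \<in> set (leaves s)" and y: "y \<in> set (leaves s)" and eq: "h x = h y" and "x \<noteq> y"
  then have "pos (leaves s) x \<noteq> pos (leaves s) y" using pos_inj by metis
  then consider "pos (leaves s) x < pos (leaves s) y" | "pos (leaves s) y < pos (leaves s) x"
    by linarith
  then show False
    using ordered_embeddingD(2)[OF h x y] ordered_embeddingD(2)[OF h y x] eq by cases simp_all
qed

text \<open>Adding \<open>r\<close> on the right neither moves the leaves of \<open>l\<close> nor
  creates edges between them: an edge of \<open>r\<close> or of the join has an end among the leaves
  of \<open>r\<close>.\<close>

lemma ordered_embedding_left:
  assumes h: "ordered_embedding s l h" and dist: "distinct (leaves (Node b l r))"
  shows "ordered_embedding s (Node b l r) h"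
  unfolding ordered_embedding_def
proof (intro conjI ballI impI)
  show "h ` set (leaves s) \<subseteq> set (leaves (Node b l r))"
    using h by (auto simp: ordered_embedding_def)
  fix x y assume xy: "x \<in> set (leaves s)" "y \<in> set (leaves s)"
  have hl: "h x \<in> set (leaves l)" "h y \<in> set (leaves l)"
    using ordered_embeddingD(1)[OF h] xy by auto
  then have hr: "h x \<notin> set (leaves r)" "h y \<notin> set (leaves r)"
    using dist by auto
  show "pos (leaves (Node b l r)) (h x) < pos (leaves (Node b l r)) (h y)"
    if "pos (leaves s) x < pos (leaves s) y"
    using ordered_embeddingD(2)[OF h xy that] hl by (simp add: pos_append)
  show "{h x, h y} \<in> edges (cotree_graph (Node b l r)) \<longleftrightarrow> {x, y} \<in> edges (cotree_graph s)"
    using ordered_embeddingD(3)[OF h xy] hr edge_cotree_graph_leaf(1)[of "h x" "h y" r]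
    unfolding edge_cotree_graph_Node by blast
qed

lemma ordered_embedding_right:
  assumes h: "ordered_embedding s r h" and dist: "distinct (leaves (Node b l r))"
  shows "ordered_embedding s (Node b l r) h"
  unfolding ordered_embedding_def
proof (intro conjI ballI impI)
  show "h ` set (leaves s) \<subseteq> set (leaves (Node b l r))"
    using h by (auto simp: ordered_embedding_def)
  fix x y assume xy: "x \<in> set (leaves s)" "y \<in> set (leaves s)"
  have "h x \<in> set (leaves r)" "h y \<in> set (leaves r)"
    using ordered_embeddingD(1)[OF h] xy by auto
  then have hl: "h x \<notin> set (leaves l)" "h y \<notin> set (leaves l)"
    using dist by auto
  show "pos (leaves (Node b l r)) (h x) < pos (leaves (Node b l r)) (h y)"
    if "pos (leaves s) x < pos (leaves s) y"
    using ordered_embeddingD(2)[OF h xy that] hl by (simp add: pos_append)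
  show "{h x, h y} \<in> edges (cotree_graph (Node b l r)) \<longleftrightarrow> {x, y} \<in> edges (cotree_graph s)"
    using ordered_embeddingD(3)[OF h xy] hl edge_cotree_graph_leaf(1)[of "h x" "h y" l]
    unfolding edge_cotree_graph_Node by blast
qed

text \<open>Within one side the given maps decide. A mixed pair has its left leaf first in both
  trees and is adjacent in both exactly when the common Boolean \<open>b\<close> holds.\<close>

lemma ordered_embedding_Node:
  assumes h: "ordered_embedding l l' h" and k: "ordered_embedding r r' k"
    and dist: "distinct (leaves (Node b l r))" "distinct (leaves (Node b l' r'))"
  shows "ordered_embedding (Node b l r) (Node b l' r') (\<lambda>v. if v \<in> set (leaves l) then h v else k v)"
  unfolding ordered_embedding_def
proof (intro conjI ballI impI)
  let ?f = "\<lambda>v. if v \<in> set (leaves l) then h v else k v"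
  have L: "?f x = h x \<and> h x \<in> set (leaves l') \<and> h x \<notin> set (leaves r') \<and> x \<notin> set (leaves r)"
    if "x \<in> set (leaves l)" for x
    using ordered_embeddingD(1)[OF h that that] that dist by auto
  have R: "?f x = k x \<and> k x \<in> set (leaves r') \<and> k x \<notin> set (leaves l') \<and> x \<notin> set (leaves l)"
    if "x \<in> set (leaves r)" for x
    using ordered_embeddingD(1)[OF k that that] that dist by auto
  show "?f ` set (leaves (Node b l r)) \<subseteq> set (leaves (Node b l' r'))"
    using L R by fastforce
  fix x y assume "x \<in> set (leaves (Node b l r))" "y \<in> set (leaves (Node b l r))"
  then consider (ll) "x \<in> set (leaves l)" "y \<in> set (leaves l)" | (rr) "x \<in> set (leaves r)" "y \<in> set (leaves r)"
    | (lr) "x \<in> set (leaves l)" "y \<in> set (leaves r)" | (rl) "x \<in> set (leaves r)" "y \<in> set (leaves l)"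
    by auto
  note cases = this
  have no: "{x, y} \<notin> edges (cotree_graph t)"
    if "x \<notin> set (leaves t) \<or> y \<notin> set (leaves t)" for x y and t :: "'a cotree"
    using edge_cotree_graph_leaf[of x y t] that by blast
  show "pos (leaves (Node b l' r')) (?f x) < pos (leaves (Node b l' r')) (?f y)"
    if lt: "pos (leaves (Node b l r)) x < pos (leaves (Node b l r)) y"
    using cases
  proof cases
    case ll
    then show ?thesis
      using lt ordered_embeddingD(2)[OF h ll] L[OF ll(1)] L[OF ll(2)] by (simp add: pos_append)
  next
    case rr
    then show ?thesis
      using lt ordered_embeddingD(2)[OF k rr] R[OF rr(1)] R[OF rr(2)] by (simp add: pos_append)
  next
    case lr
    then show ?thesis
      using L[OF lr(1)] R[OF lr(2)] nth_pos(1)[of "h x" "leaves l'"] by (simp add: pos_append)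
  next
    \<comment> \<open>Excluded by \<open>lt\<close>, since every leaf of \<open>l\<close> comes
      before every leaf of \<open>r\<close>.\<close>
    case rl
    then show ?thesis
      using lt R[OF rl(1)] nth_pos(1)[OF rl(2)] by (simp add: pos_append)
  qed
  show "{?f x, ?f y} \<in> edges (cotree_graph (Node b l' r')) \<longleftrightarrow> {x, y} \<in> edges (cotree_graph (Node b l r))"
    using cases
  proof cases
    case ll
    then show ?thesis
      using ordered_embeddingD(3)[OF h ll] L[OF ll(1)] L[OF ll(2)] no[of x r y] no[of "h x" r' "h y"]
      unfolding edge_cotree_graph_Node by simp
  next
    case rr
    then show ?thesis
      using ordered_embeddingD(3)[OF k rr] R[OF rr(1)] R[OF rr(2)] no[of x l y] no[of "k x" l' "k y"]
      unfolding edge_cotree_graph_Node by simp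
  next
    case lr
    then show ?thesis
      using L[OF lr(1)] R[OF lr(2)] no[of x r y] no[of x l y] no[of "h x" r' "k y"] no[of "h x" l' "k y"]
      unfolding edge_cotree_graph_Node by simp
  next
    case rl
    then show ?thesis
      using R[OF rl(1)] L[OF rl(2)] no[of x r y] no[of x l y] no[of "k x" r' "h y"] no[of "k x" l' "h y"]
      unfolding edge_cotree_graph_Node by simp
  qed
qed

text \<open>The derivation of \<open>emb\<close> is read as a recipe for a map. With
  \<open>R\<close> as equality of suitable labels, such a map carries one basis element to
  another.\<close>

lemma emb_ordered_embedding:
  assumes "emb R s t" "distinct (leaves s)" "distinct (leaves t)"
  shows "\<exists>h. ordered_embedding s t h \<and> (\<forall>v\<in>set (leaves s). R v (h v))"
  using assms
proof (induction rule: emb.induct)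
  case (emb_Leaf a b)
  then show ?case
    by (intro exI[of _ "\<lambda>_. b"]) (auto simp: ordered_embedding_def)
next
  case (emb_left s l b r)
  then have "distinct (leaves l)" by simp
  then obtain h where h: "ordered_embedding s l h" "\<forall>v\<in>set (leaves s). R v (h v)"
    using emb_left.IH emb_left.prems by blast
  then show ?case using ordered_embedding_left[OF h(1) emb_left.prems(2)] by blast
next
  case (emb_right s r b l)
  then have "distinct (leaves r)" by simp
  then obtain h where h: "ordered_embedding s r h" "\<forall>v\<in>set (leaves s). R v (h v)"
    using emb_right.IH emb_right.prems by blast
  then show ?case using ordered_embedding_right[OF h(1) emb_right.prems(2)] by blast
next
  case (emb_Node l l' r r' b)
  have dist: "distinct (leaves l)" "distinct (leaves r)" "distinct (leaves l')" "distinct (leaves r')"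
    using emb_Node.prems by simp_all
  obtain h where h: "ordered_embedding l l' h" "\<forall>v\<in>set (leaves l). R v (h v)"
    using emb_Node.IH(1) dist by blast
  obtain k where k: "ordered_embedding r r' k" "\<forall>v\<in>set (leaves r). R v (k v)"
    using emb_Node.IH(2) dist by blast
  show ?case
    using ordered_embedding_Node[OF h(1) k(1) emb_Node.prems] h(2) k(2)
    by (intro exI[of _ "\<lambda>v. if v \<in> set (leaves l) then h v else k v"]) auto
qed

lemma ordered_embedding_cong:
  assumes "\<And>v. v \<in> set (leaves s) \<Longrightarrow> h v = k v"
  shows "ordered_embedding s t h \<longleftrightarrow> ordered_embedding s t k"
  using assms by (simp add: ordered_embedding_def)

lemma ordered_embedding_full:
  assumes h: "ordered_embedding s t h"
  shows "restrict h (set (leaves s)) \<in> full_embeddings (cotree_graph s) (cotree_graph t)"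
  using ordered_embeddingD[OF h] ordered_embedding_inj[OF h]
  by (simp add: full_embeddings_def embeddings_def inj_on_restrict_eq)

text \<open>At the first difference the embedding preserves the inequality; before it, equal
  positions mean equal vertices, whose images agree as well. The order on lists compares lengths
  first, so only lists of equal length are at issue here.\<close>

lemma map_pos_less:
  assumes "ordered_embedding s t h" "length xs = length ys"
    and "set xs \<subseteq> set (leaves s)" "set ys \<subseteq> set (leaves s)"
    and "map (pos (leaves s)) xs < map (pos (leaves s)) ys"
  shows "map (\<lambda>v. pos (leaves t) (h v)) xs < map (\<lambda>v. pos (leaves t) (h v)) ys"
  using assms(2-)
proof (induction xs ys rule: list_induct2)
  case (Cons x xs y ys)
  then have "pos (leaves s) x < pos (leaves s) y \<or>
      pos (leaves s) x = pos (leaves s) y \<and> map (pos (leaves s)) xs < map (pos (leaves s)) ys"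
    by (auto simp: Cons_less_Cons)
  then show ?case
  proof (elim disjE conjE)
    assume "pos (leaves s) x < pos (leaves s) y"
    then show ?thesis
      using ordered_embeddingD(2)[OF assms(1), of x y] Cons by (simp add: Cons_less_Cons)
  next
    assume "pos (leaves s) x = pos (leaves s) y" and lt: "map (pos (leaves s)) xs < map (pos (leaves s)) ys"
    then have "x = y" using Cons.prems pos_inj[of x "leaves s" y] by simp
    then show ?thesis using Cons lt by (simp add: Cons_less_Cons)
  qed
qed simp

section \<open>The cover of the category of cographs by cotrees\<close>

lemma CFE_simps:
  "Obj CFE = {G. cograph G}"
  "Hom CFE = full_embeddings"
  "Comp CFE G H K g f = compose (verts G) g f"
  by (simp_all add: CFE_def)

text \<open>\<open>vs i\<close> is a fixed enumeration of the vertices of \<open>b i\<close>,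
  possibly with repetitions. The positions of the images determine \<open>g\<close>, and the index
  \<open>i\<close> in front separates the summands. Postcomposition leaves lengths unchanged, so it
  respects the length-first order, which is a well-order on lists of naturals.\<close>

lemma groebner_cover_CFE:
  fixes b :: "nat \<Rightarrow> 'v sgraph"
  assumes b: "\<And>i. i < n \<Longrightarrow> cograph (b i)"
  defines "vs \<equiv> \<lambda>i. SOME xs. set xs = verts (b i)"
  shows "groebner_cover CFE n b {t. distinct (leaves t) \<and> cograph (cotree_graph t)} cotree_graph
    (\<lambda>s t. {h \<in> full_embeddings (cotree_graph s) (cotree_graph t). ordered_embedding s t h})
    (\<lambda>t i g. i # map (\<lambda>v. pos (leaves t) (g v)) (vs i))"
proof -
  let ?T = "{t :: 'v cotree. distinct (leaves t) \<and> cograph (cotree_graph t)}"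
  have finv: "finite (verts G)" if "cograph G" for G :: "'v sgraph"
    using cograph_simple_graph[OF that] by (simp add: simple_graph_def)
  have vs: "set (vs i) = verts (b i)" if "i < n" for i
    unfolding vs_def using finite_list[OF finv[OF b[OF that]]] by (rule someI_ex)
  have mem: "f v \<in> set (leaves t)" if "f \<in> full_embeddings (b i) (cotree_graph t)" "v \<in> verts (b i)" for f v t i
    using full_embeddings_PiE[OF that(1)] that(2) by auto
  have wqo: "wqo_on (\<lambda>(s, i, f) (t, j, g).
      \<exists>h\<in>{h \<in> full_embeddings (cotree_graph s) (cotree_graph t). ordered_embedding s t h}.
        i = j \<and> compose (verts (b i)) h f = g)
      {(t, i, f). t \<in> ?T \<and> i < n \<and> f \<in> full_embeddings (b i) (cotree_graph t)}" (is "wqo_on ?D ?B")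
    unfolding wqo_on_def
  proof (intro allI impI)
    fix q :: "nat \<Rightarrow> 'v cotree \<times> nat \<times> ('v \<Rightarrow> 'v)"
    assume q: "range q \<subseteq> ?B"
    define t i f where "t k = fst (q k)" and "i k = fst (snd (q k))" and "f k = snd (snd (q k))" for k
    have qk: "q k = (t k, i k, f k)" for k
      by (simp add: t_def i_def f_def)
    have tif: "distinct (leaves (t k))" "i k < n" "f k \<in> full_embeddings (b (i k)) (cotree_graph (t k))" for k
      using q qk[of k] by (auto simp: image_subset_iff dest: spec[of _ k])
    \<comment> \<open>The preimage is kept as a set, empty or a singleton by injectivity, so that
      leaves outside the image get a label too and only finitely many labels occur.\<close>
    define lab where "lab k v = (i k, {w \<in> verts (b (i k)). f k w = v})" for k v
    define L where "L = {..<n} \<times> Pow (\<Union>i<n. verts (b i))"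
    have "finite L"
      unfolding L_def using finv b by (intro finite_cartesian_product) auto
    then have "wqo_on (emb (=)) {t. set_cotree t \<subseteq> L}"
      by (intro wqo_on_emb wqo_on_eq_finite)
    moreover have "map_cotree (lab k) (t k) \<in> {t. set_cotree t \<subseteq> L}" for k
      using tif(2)[of k] by (auto simp: lab_def L_def cotree.set_map)
    ultimately obtain k m where "k < m" and "emb (=) (map_cotree (lab k) (t k)) (map_cotree (lab m) (t m))"
      by (rule wqo_on_good)
    from emb_ordered_embedding[OF emb_map[OF this(2)] tif(1) tif(1)]
    obtain h where h: "ordered_embedding (t k) (t m) h" and lab: "\<forall>v\<in>set (leaves (t k)). lab k v = lab m (h v)"
      by blast
    let ?h = "restrict h (set (leaves (t k)))"
    \<comment> \<open>The summand index is part of every label, and a tree has at least one leaf to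
      read it from.\<close>
    obtain v where "v \<in> set (leaves (t k))" using leaves_nonempty[of "t k"] by fastforce
    then have i: "i k = i m" using lab by (auto simp: lab_def)
    have "compose (verts (b (i k))) ?h (f k) = f m"
    proof
      fix w
      show "compose (verts (b (i k))) ?h (f k) w = f m w"
      proof (cases "w \<in> verts (b (i k))")
        case True
        then have fw: "f k w \<in> set (leaves (t k))" using mem[OF tif(3)] by blast
        \<comment> \<open>Equal labels at \<open>f k w\<close> and at its image under
          \<open>h\<close> mean equal preimages; \<open>w\<close> lies in the first, hence in the
          second.\<close>
        have "{w' \<in> verts (b (i k)). f k w' = f k w} = {w' \<in> verts (b (i m)). f m w' = h (f k w)}"
          using bspec[OF lab fw] unfolding lab_def prod.inject by (rule conjunct2)
        then have "f m w = h (f k w)" using True by blast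
        then show ?thesis using True fw by (simp add: compose_def)
      next
        case False
        then show ?thesis
          using full_embeddings_PiE[OF tif(3)[of m]] i by (auto simp: compose_def PiE_def extensional_def)
      qed
    qed
    moreover have "ordered_embedding (t k) (t m) ?h"
      using h ordered_embedding_cong[of "t k" ?h h] by simp
    ultimately have "?D (q k) (q m)"
      unfolding qk using ordered_embedding_full[OF h] i by auto
    with \<open>k < m\<close> show "\<exists>k m. k < m \<and> ?D (q k) (q m)"
      by (intro exI[of _ k] exI[of _ m] conjI)
  qed
  show ?thesis
  proof (intro groebner_cover.intro category_CFE groebner_cover_axioms.intro)
    show "finite (Hom CFE G H)" if "G \<in> Obj CFE" "H \<in> Obj CFE" for G H :: "'v sgraph"
    proof (rule finite_subset)
      show "Hom CFE G H \<subseteq> verts G \<rightarrow>\<^sub>E verts H"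
        using full_embeddings_PiE by (auto simp: CFE_def)
      show "finite (verts G \<rightarrow>\<^sub>E verts H)"
        using that finv by (intro finite_PiE) (auto simp: CFE_def)
    qed
    show "b i \<in> Obj CFE" if "i < n" for i
      using b[OF that] by (simp add: CFE_def)
    \<comment> \<open>The index set itself demands that \<open>cotree_graph t\<close> be a cograph,
      so all the content lies in the existence of a cotree for every cograph.\<close>
    show "cotree_graph ` ?T = Obj CFE"
      using cograph_cotree by (fastforce simp: CFE_def)
    show "{h \<in> full_embeddings (cotree_graph s) (cotree_graph t). ordered_embedding s t h}
        \<subseteq> Hom CFE (cotree_graph s) (cotree_graph t)" for s t :: "'v cotree"
      by (auto simp: CFE_def)
    show "i = j \<and> f = g"
      if "i < n" "f \<in> Hom CFE (b i) (cotree_graph t)" "g \<in> Hom CFE (b j) (cotree_graph t)"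
        "i # map (\<lambda>v. pos (leaves t) (f v)) (vs i) = j # map (\<lambda>v. pos (leaves t) (g v)) (vs j)"
      for t i j f g
    proof
      show ij: "i = j" using that(4) by simp
      have f: "f \<in> full_embeddings (b i) (cotree_graph t)" and g: "g \<in> full_embeddings (b i) (cotree_graph t)"
        using that(2,3) ij by (simp_all add: CFE_def)
      have "f v = g v" if "v \<in> verts (b i)" for v
        using \<open>i # _ = _\<close> ij vs[OF \<open>i < n\<close>] that pos_inj[OF mem[OF f that] mem[OF g that]]
        by auto
      then show "f = g"
        using PiE_ext[OF full_embeddings_PiE[OF f] full_embeddings_PiE[OF g]] by blast
    qed
    show "i # map (\<lambda>v. pos (leaves t) (Comp CFE (b i) (cotree_graph s) (cotree_graph t) h f v)) (vs i)
        < j # map (\<lambda>v. pos (leaves t) (Comp CFE (b j) (cotree_graph s) (cotree_graph t) h g v)) (vs j)"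
      if h: "h \<in> {h \<in> full_embeddings (cotree_graph s) (cotree_graph t). ordered_embedding s t h}"
        and i: "i < n" and j: "j < n"
        and f: "f \<in> Hom CFE (b i) (cotree_graph s)" and g: "g \<in> Hom CFE (b j) (cotree_graph s)"
        and less: "i # map (\<lambda>v. pos (leaves s) (f v)) (vs i) < j # map (\<lambda>v. pos (leaves s) (g v)) (vs j)"
      for s t h i j f g
    proof -
      have f': "f \<in> full_embeddings (b i) (cotree_graph s)" and g': "g \<in> full_embeddings (b j) (cotree_graph s)"
        using f g by (simp_all add: CFE_def)
      have comp: "map (\<lambda>v. pos (leaves t) (Comp CFE (b i) (cotree_graph s) (cotree_graph t) h f v)) (vs i)
          = map (\<lambda>v. pos (leaves t) (h v)) (map f (vs i))" if "i < n" for i f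
        using vs[OF that] by (simp add: CFE_def compose_def)
      have sub: "set (map f (vs i)) \<subseteq> set (leaves s)" "set (map g (vs j)) \<subseteq> set (leaves s)"
        using mem[OF f'] mem[OF g'] vs i j by auto
      have lt: "map (\<lambda>v. pos (leaves t) (h v)) (map f (vs i)) < map (\<lambda>v. pos (leaves t) (h v)) (map g (vs j))"
        if "length (vs i) = length (vs j)"
          "map (\<lambda>v. pos (leaves s) (f v)) (vs i) < map (\<lambda>v. pos (leaves s) (g v)) (vs j)"
      proof (rule map_pos_less[OF _ _ sub])
        show "ordered_embedding s t h" using h by blast
        show "length (map f (vs i)) = length (map g (vs j))" using that(1) by simp
        show "map (pos (leaves s)) (map f (vs i)) < map (pos (leaves s)) (map g (vs j))"
          using that(2) by (simp add: comp_def)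
      qed
      \<comment> \<open>Lengths and summand indices are untouched by composition with
        \<open>h\<close>; only the last alternative uses monotonicity of positions.\<close>
      have "length (vs i) < length (vs j) \<or> length (vs i) = length (vs j) \<and>
          (i < j \<or> i = j \<and> map (\<lambda>v. pos (leaves s) (f v)) (vs i) < map (\<lambda>v. pos (leaves s) (g v)) (vs j))"
        using less unfolding Cons_less_Cons length_map .
      then show ?thesis
        unfolding comp[OF i] comp[OF j] Cons_less_Cons length_map using lt by blast
    qed
    show "wqo_on (\<lambda>(s, i, f) (t, j, g).
      \<exists>h\<in>{h \<in> full_embeddings (cotree_graph s) (cotree_graph t). ordered_embedding s t h}.
        i = j \<and> Comp CFE (b i) (cotree_graph s) (cotree_graph t) h f = g)
      {(t, i, f). t \<in> ?T \<and> i < n \<and> f \<in> Hom CFE (b i) (cotree_graph t)}"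
      using wqo unfolding CFE_simps .
  qed
qed

theorem theorem7p2:
  fixes A :: "('a, 'r) ring_scheme"
  assumes "cring A" and "noetherian_ring A"
  shows "noetherian_over TYPE('x) (CFE :: ('v sgraph, 'v \<Rightarrow> 'v) cat) A"
  unfolding noetherian_over_def
proof (intro allI impI, elim conjE)
  fix M :: "('v sgraph, 'v \<Rightarrow> 'v, 'a, 'x) cmod" and N
  assume M: "cat_module CFE A M" and fg: "finitely_generated CFE A M" and N: "sub_cmod CFE A M N"
  obtain n :: nat and b \<phi> where b: "\<forall>i<n. b i \<in> Obj CFE"
    and \<phi>: "surjection CFE A (direct_sum_cmod {..<n} (\<lambda>i. free_cmod CFE A (b i))) M \<phi>"
    using fg unfolding finitely_generated_def by blast
  have "cograph (b i)" if "i < n" for i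
    using b that by (simp add: CFE_def)
  from groebner_cover.finitely_generated_restrict[OF groebner_cover_CFE[OF this] assms(2) M \<phi> N]
  show "finitely_generated CFE A (restrict_cmod M N)" by blast
qed

end
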